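(* Let $\Omega\subsetneq\mathbb{R}^n$ be a domain. Let $\delta>0$ and $c\ge1$ be fixed. Let $\phi$ be an increasing non-negative function on $[0,\infty)$ such that there are numbers $d_\phi\ge c_\phi\ge c\ge2$ with $$1+\phi(t)\le\frac{t}{2c}\quad\text{for all }t\ge c_\phi,\qquad\text{and}\qquad 1+\phi(t)\le\frac{t}{c_\phi e^{8c_\phi}}\quad\text{for all }t\ge d_\phi.$$ Suppose that $x,y\in\Omega$ and that $\gamma_{x,y}$ is a quasihyperbolic geodesic in $\Omega$ between $x$ and $y$ satisfying the following properties: (i) for all $u,v\in\gamma_{x,y}$ with $|u-v|<\delta$, $$k_\Omega(u,v)\le c\left[1+\frac12\left(\phi\left(\frac{|u-v|}{d_\Omega(u)}\right)+\phi\left(\frac{|u-v|}{d_\Omega(v)}\right)\right)\right];$$ (ii) $|x-y|<\delta/(10c_\phi)$. Then $$|\gamma_{x,y}|\le a|x-y|\qquad\text{and}\qquad\min\{|\gamma_{x,z}|,|\gamma_{y,z}|\}\le b\,d_\Omega(z)\quad\text{for all }z\in\gamma_{x,y},$$ with $a=8d_\phi$ and $b=2d_\phi^2$.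
   Context: A domain is a nonempty open connected set. $d_\Omega(x)=\mathrm{dist}(x,\partial\Omega)$. For a rectifiable curve $\gamma$, $|\gamma|$ denotes its arclength; for points $p,q$ along a curve $\gamma_{x,y}$ from $x$ to $y$, $\gamma_{p,q}$ denotes the portion of the curve between $p$ and $q$. The quasihyperbolic metric is $$k_\Omega(x,y)=\inf_{\gamma}\int_{\gamma}\frac{ds}{d_\Omega(z)},\qquad x,y\in\Omega,$$ the infimum being over all rectifiable curves $\gamma\subset\Omega$ connecting $x$ and $y$, with $ds$ arclength. A quasihyperbolic geodesic between $x$ and $y$ is a rectifiable curve $\gamma\subset\Omega$ connecting $x$ and $y$ with $\int_\gamma\frac{ds}{d_\Omega(z)}=k_\Omega(x,y)$. *)

theory Defs
  imports "HOL-Analysis.Analysis"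
begin

text \<open>Curves are library paths, parametrized by \<open>{0..1}\<close>.\<close>

definition inscribed_lengths :: "(real \<Rightarrow> 'a::metric_space) \<Rightarrow> real set" where
  "inscribed_lengths g =
     {(\<Sum>i<n. dist (g (t i)) (g (t (Suc i)))) |(n::nat) (t::nat \<Rightarrow> real).
        t 0 = 0 \<and> t n = 1 \<and> mono_on {..n} t}"

definition rectifiable_path :: "(real \<Rightarrow> 'a::metric_space) \<Rightarrow> bool" where
  "rectifiable_path g \<longleftrightarrow> path g \<and> bdd_above (inscribed_lengths g)"

text \<open>Meaningful for rectifiable paths only: the supremum is taken in the reals.\<close>

definition arclength :: "(real \<Rightarrow> 'a::metric_space) \<Rightarrow> real" where
  "arclength g = Sup (inscribed_lengths g)"

text \<open>
  The point of \<open>g\<close> reached after arclength \<open>s\<close>, for \<open>0 \<le> s \<le> arclength g\<close>. If several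
  parameters give the same arclength \<open>s\<close>, then \<open>g\<close> is constant between them, so
  the choice made by \<^const>\<open>inv_into\<close> is irrelevant.
\<close>

definition arclength_param :: "(real \<Rightarrow> 'a::real_normed_vector) \<Rightarrow> real \<Rightarrow> 'a" where
  "arclength_param g s = g (inv_into {0..1} (\<lambda>t. arclength (subpath 0 t g)) s)"

definition arclength_integral ::
    "('a::real_normed_vector \<Rightarrow> real) \<Rightarrow> (real \<Rightarrow> 'a) \<Rightarrow> real" where
  "arclength_integral f g = integral {0..arclength g} (\<lambda>s. f (arclength_param g s))"

definition boundary_dist :: "'a::metric_space set \<Rightarrow> 'a \<Rightarrow> real" where
  "boundary_dist \<Omega> z = infdist z (frontier \<Omega>)"

definition rectifiable_paths_between ::
    "'a::metric_space set \<Rightarrow> 'a \<Rightarrow> 'a \<Rightarrow> (real \<Rightarrow> 'a) set" where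
  "rectifiable_paths_between \<Omega> x y =
     {g. rectifiable_path g \<and> path_image g \<subseteq> \<Omega> \<and> pathstart g = x \<and> pathfinish g = y}"

definition qh_length :: "'a::real_normed_vector set \<Rightarrow> (real \<Rightarrow> 'a) \<Rightarrow> real" where
  "qh_length \<Omega> g = arclength_integral (\<lambda>z. 1 / boundary_dist \<Omega> z) g"

definition qh_metric :: "'a::real_normed_vector set \<Rightarrow> 'a \<Rightarrow> 'a \<Rightarrow> real" where
  "qh_metric \<Omega> x y = (INF g \<in> rectifiable_paths_between \<Omega> x y. qh_length \<Omega> g)"

definition qh_geodesic ::
    "'a::real_normed_vector set \<Rightarrow> 'a \<Rightarrow> 'a \<Rightarrow> (real \<Rightarrow> 'a) \<Rightarrow> bool" where
  "qh_geodesic \<Omega> x y g \<longleftrightarrow>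
     g \<in> rectifiable_paths_between \<Omega> x y \<and> qh_length \<Omega> g = qh_metric \<Omega> x y"

definition is_domain :: "'a::topological_space set \<Rightarrow> bool" where
  "is_domain \<Omega> \<longleftrightarrow> \<Omega> \<noteq> {} \<and> open \<Omega> \<and> connected \<Omega>"

end

theory Submission
  imports Defs
begin

text \<open>
  Parametrize the geodesic by arclength and put \<open>f s\<close> for the boundary distance at parameter \<open>s\<close>, so
  that subarcs of a geodesic being geodesic turns (i) into an upper bound for \<open>\<integral> 1 / f\<close> over short
  parameter intervals \<open>[u, v]\<close>. When \<open>v - u\<close> is at least \<open>c\<^sub>\<phi> f u\<close> and \<open>c\<^sub>\<phi> f v\<close>, this bound is half the
  trapezoidal approximation \<open>(v - u) / 2 \<cdot> (1 / f u + 1 / f v)\<close>, which is incompatible with \<open>f\<close> staying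
  comparable to its maximum \<open>R\<close>. Consequently an arc on which \<open>f \<le> R\<close> has length at most
  \<open>6 c\<^sub>\<phi> R\<close>. If \<open>|x - y|\<close> is small compared with the boundary distance at \<open>x\<close>, the segment
  from \<open>x\<close> to \<open>y\<close> bounds the quasihyperbolic distance. Otherwise cut the geodesic at the first and last points
  of level \<open>|x - y| / 2\<close>: the outer arcs are low, hence short, and the cut points are close enough for (i) to bound
  their quasihyperbolic distance by \<open>1 + 6 c\<^sub>\<phi>\<close>. The factor \<open>exp (8 c\<^sub>\<phi>) \<le> d\<^sub>\<phi>\<close>, forced by \<open>\<phi> \<ge> 0\<close>,
  absorbs the resulting exponentials.
\<close>

subsection \<open>Arclength\<close>

text \<open>Inscribed lengths on an arbitrary parameter interval, so that additivity of length can
  be proved on one fixed path without reparametrizing by \<open>subpath\<close>.\<close>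

definition partition_sums :: "(real \<Rightarrow> 'a::metric_space) \<Rightarrow> real \<Rightarrow> real \<Rightarrow> real set" where
  "partition_sums g a b =
     {(\<Sum>i<n. dist (g (t i)) (g (t (Suc i)))) |(n::nat) (t::nat \<Rightarrow> real).
        t 0 = a \<and> t n = b \<and> mono_on {..n} t}"

definition variation :: "(real \<Rightarrow> 'a::metric_space) \<Rightarrow> real \<Rightarrow> real \<Rightarrow> real" where
  "variation g a b = Sup (partition_sums g a b)"

lemma inscribed_lengths_eq: "inscribed_lengths g = partition_sums g 0 1"
  by (simp add: inscribed_lengths_def partition_sums_def)

lemma arclength_eq: "arclength g = variation g 0 1"
  by (simp add: arclength_def variation_def inscribed_lengths_eq)

lemma partition_sumsI:
  assumes "t 0 = a" "t n = b" "mono_on {..n} t"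
  shows "(\<Sum>i<n. dist (g (t i)) (g (t (Suc i)))) \<in> partition_sums g a b"
  using assms by (auto simp: partition_sums_def)

lemma partition_sumsD:
  assumes "s \<in> partition_sums g a b"
  shows "\<exists>n t. s = (\<Sum>i<n. dist (g (t i)) (g (t (Suc i)))) \<and> t 0 = a \<and> t n = b \<and>
    mono_on {..n} t \<and> (\<forall>i\<le>n. t i \<in> {a..b}) \<and> (\<forall>i<n. t i \<le> t (Suc i))"
proof -
  obtain n t where nt: "s = (\<Sum>i<n. dist (g (t i)) (g (t (Suc i))))" "t 0 = a" "t n = b"
    "mono_on {..n} t"
    using assms by (auto simp: partition_sums_def)
  have mono: "t i \<le> t j" if "i \<le> j" "j \<le> n" for i j
    using nt(4) that by (auto simp: mono_on_def)
  show ?thesis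
    using mono[of 0] mono[of _ n] mono[of _ "Suc _"] nt by (intro exI[of _ n] exI[of _ t]) auto
qed

lemma partition_sums_le: "s \<in> partition_sums g a b \<Longrightarrow> a \<le> b"
  using partition_sumsD by fastforce

lemma dist_in_partition_sums:
  assumes "a \<le> b"
  shows "dist (g a) (g b) \<in> partition_sums g a b"
  using partition_sumsI[of "\<lambda>i. if i = 0 then a else b" a 1 b g] assms
  by (auto simp: mono_on_def)

lemma partition_sums_append:
  assumes "r \<in> partition_sums g a b" "s \<in> partition_sums g b c"
  shows "r + s \<in> partition_sums g a c"
proof -
  obtain n t where t: "r = (\<Sum>i<n. dist (g (t i)) (g (t (Suc i))))" "t 0 = a" "t n = b"
    "mono_on {..n} t" "\<And>i. i \<le> n \<Longrightarrow> t i \<in> {a..b}"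
    using partition_sumsD[OF assms(1)] by blast
  obtain m u where u: "s = (\<Sum>i<m. dist (g (u i)) (g (u (Suc i))))" "u 0 = b" "u m = c"
    "mono_on {..m} u" "\<And>i. i \<le> m \<Longrightarrow> u i \<in> {b..c}"
    using partition_sumsD[OF assms(2)] by blast
  define w where "w i = (if i \<le> n then t i else u (i - n))" for i
  \<comment> \<open>Holds at \<open>i = 0\<close> as well, because the last point of
    \<open>t\<close> and the first point of \<open>u\<close> are both \<open>b\<close>.\<close>
  have w_hi: "w (n + i) = u i" for i
    using t(3) u(2) by (simp add: w_def)
  have "mono_on {..n + m} w"
  proof (rule mono_onI)
    fix i j assume ij: "i \<in> {..n + m}" "j \<in> {..n + m}" "i \<le> j"
    consider "j \<le> n" | "i \<le> n" "n < j" | "n < i" using ij by linarith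
    then show "w i \<le> w j"
    proof cases
      case 1
      then show ?thesis using t(4) ij by (simp add: w_def mono_on_def)
    next
      case 2
      then show ?thesis using t(5)[of i] u(5)[of "j - n"] ij by (fastforce simp: w_def)
    next
      case 3
      then show ?thesis using mono_onD[OF u(4), of "i - n" "j - n"] ij by (simp add: w_def)
    qed
  qed
  moreover have "w 0 = a" "w (n + m) = c"
    using t(2) w_hi[of m] u(3) by (auto simp: w_def)
  ultimately have "(\<Sum>i<n + m. dist (g (w i)) (g (w (Suc i)))) \<in> partition_sums g a c"
    by (intro partition_sumsI)
  moreover have "(\<Sum>i<n + m. dist (g (w i)) (g (w (Suc i)))) = r + s"
  proof -
    have "(\<Sum>i<n + m. dist (g (w i)) (g (w (Suc i)))) =
        (\<Sum>i<n. dist (g (w i)) (g (w (Suc i)))) + (\<Sum>i<m. dist (g (w (n + i))) (g (w (n + Suc i))))"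
      by (induction m) auto
    also have "\<dots> = r + s"
      unfolding w_hi t(1) u(1) by (simp add: w_def)
    finally show ?thesis .
  qed
  ultimately show ?thesis by simp
qed

text \<open>Truncating at \<open>b\<close> from both sides inserts \<open>b\<close> into a partition without locating its cell.\<close>

lemma partition_split:
  fixes t :: "nat \<Rightarrow> real"
  assumes "\<And>i. i < n \<Longrightarrow> t i \<le> t (Suc i)"
  shows "(\<Sum>i<n. dist (g (t i)) (g (t (Suc i)))) \<le>
     (\<Sum>i<n. dist (g (min (t i) b)) (g (min (t (Suc i)) b))) +
     (\<Sum>i<n. dist (g (max (t i) b)) (g (max (t (Suc i)) b)))"
  unfolding sum.distrib[symmetric]
proof (rule sum_mono)
  fix i assume "i \<in> {..<n}"
  then have "t i \<le> t (Suc i)" using assms by auto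
  then consider "t (Suc i) \<le> b" | "b \<le> t i" | "t i < b" "b < t (Suc i)" by linarith
  then show "dist (g (t i)) (g (t (Suc i))) \<le>
      dist (g (min (t i) b)) (g (min (t (Suc i)) b)) + dist (g (max (t i) b)) (g (max (t (Suc i)) b))"
    by cases (use \<open>t i \<le> t (Suc i)\<close> in \<open>auto simp: min_def max_def intro: dist_triangle\<close>)
qed

lemma mono_on_min_max:
  fixes t :: "'a::order \<Rightarrow> real"
  assumes "mono_on A t"
  shows "mono_on A (\<lambda>i. min (t i) b)" "mono_on A (\<lambda>i. max (t i) b)"
  by (auto intro!: mono_onI min.mono max.mono mono_onD[OF assms])

text \<open>Partitions are only weakly monotone, so the repeated points created by truncation are
  legitimate and contribute nothing to the sums.\<close>

lemma partition_sums_split: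
  assumes "s \<in> partition_sums g a c" "b \<in> {a..c}"
  obtains r1 r2 where "r1 \<in> partition_sums g a b" "r2 \<in> partition_sums g b c" "s \<le> r1 + r2"
proof -
  obtain n t where t: "s = (\<Sum>i<n. dist (g (t i)) (g (t (Suc i))))" "t 0 = a" "t n = c"
    "mono_on {..n} t" "\<And>i. i < n \<Longrightarrow> t i \<le> t (Suc i)"
    using partition_sumsD[OF assms(1)] by blast
  show ?thesis
  proof (rule that)
    show "(\<Sum>i<n. dist (g (min (t i) b)) (g (min (t (Suc i)) b))) \<in> partition_sums g a b"
      using t assms(2) by (intro partition_sumsI mono_on_min_max) auto
    show "(\<Sum>i<n. dist (g (max (t i) b)) (g (max (t (Suc i)) b))) \<in> partition_sums g b c"
      using t assms(2) by (intro partition_sumsI mono_on_min_max) auto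
  qed (use partition_split t in auto)
qed

lemma partition_sums_cong:
  assumes "\<And>x. x \<in> {a..b} \<Longrightarrow> g x = h x"
  shows "partition_sums g a b = partition_sums h a b"
proof -
  have *: "partition_sums g a b \<subseteq> partition_sums h a b"
    if eq: "\<And>x. x \<in> {a..b} \<Longrightarrow> g x = h x" for g h :: "real \<Rightarrow> 'a"
  proof
    fix s assume "s \<in> partition_sums g a b"
    from partition_sumsD[OF this]
    obtain n t where t: "s = (\<Sum>i<n. dist (g (t i)) (g (t (Suc i))))" "t 0 = a" "t n = b"
      "mono_on {..n} t" "\<And>i. i \<le> n \<Longrightarrow> t i \<in> {a..b}"
      by blast
    have "s = (\<Sum>i<n. dist (h (t i)) (h (t (Suc i))))"
      unfolding t(1) by (rule sum.cong) (use t(5) eq in auto)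
    then show "s \<in> partition_sums h a b" using partition_sumsI[OF t(2-4)] by simp
  qed
  show ?thesis using *[of g h] *[of h g] assms by auto
qed

lemma partition_sums_const:
  assumes "u \<le> v" "\<And>x. x \<in> {u..v} \<Longrightarrow> g x = z"
  shows "partition_sums g u v = {0}"
proof -
  have "partition_sums g u v = partition_sums (\<lambda>_. z) u v"
    using assms by (intro partition_sums_cong)
  also have "\<dots> = {0}"
    using dist_in_partition_sums[OF assms(1), of "\<lambda>_. z"] by (auto simp: partition_sums_def)
  finally show ?thesis .
qed

lemma partition_sums_affine:
  fixes m :: real
  assumes "m > 0"
  shows "partition_sums (\<lambda>x. g (m * x + k)) a b = partition_sums g (m * a + k) (m * b + k)"
proof -
  have *: "partition_sums (\<lambda>x. g (m * x + k)) a b \<subseteq> partition_sums g (m * a + k) (m * b + k)"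
    if "m > 0" for g :: "real \<Rightarrow> 'a" and m k a b :: real
  proof
    fix s assume "s \<in> partition_sums (\<lambda>x. g (m * x + k)) a b"
    from partition_sumsD[OF this]
    obtain n t where t: "s = (\<Sum>i<n. dist (g (m * t i + k)) (g (m * t (Suc i) + k)))"
      "t 0 = a" "t n = b" "mono_on {..n} t"
      by blast
    show "s \<in> partition_sums g (m * a + k) (m * b + k)"
      using partition_sumsI[of "\<lambda>i. m * t i + k" "m * a + k" n "m * b + k" g] t that
      by (auto simp: mono_on_def)
  qed
  \<comment> \<open>The reverse inclusion is the first one for the inverse affine map, applied to
    the reparametrized path.\<close>
  have "g = (\<lambda>x. g (m * ((1 / m) * x + (- k / m)) + k))"
    using assms by (auto simp: field_simps)
  then show ?thesis
    using *[of m g k a b] *[of "1/m" "\<lambda>x. g (m * x + k)" "- k / m" "m * a + k" "m * b + k"] assms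
    by (auto simp: field_simps)
qed

text \<open>For \<open>a = b\<close> the affine change of parameter is constant; both sides are then
  \<open>{0}\<close>.\<close>

lemma partition_sums_subpath:
  assumes "a \<le> b" "u \<le> v"
  shows "partition_sums (subpath a b g) u v = partition_sums g ((b - a) * u + a) ((b - a) * v + a)"
proof (cases "a = b")
  case True
  then show ?thesis
    using assms partition_sums_const[of u v "subpath a b g" "g a"] partition_sums_const[of a a g "g a"]
    by (auto simp: subpath_def)
next
  case False
  then show ?thesis
    using assms partition_sums_affine[of "b - a" g a u v] by (simp add: subpath_def)
qed

text \<open>Adding the chords from \<open>g 0\<close> to \<open>g a\<close> and from
  \<open>g b\<close> to \<open>g 1\<close> turns a sum on \<open>{a..b}\<close> into one on
  \<open>{0..1}\<close>.\<close>

lemma bdd_above_partition_sums: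
  assumes "rectifiable_path g" "0 \<le> a" "a \<le> b" "b \<le> 1"
  shows "bdd_above (partition_sums g a b)"
proof -
  obtain M where M: "\<And>s. s \<in> partition_sums g 0 1 \<Longrightarrow> s \<le> M"
    using assms by (auto simp: rectifiable_path_def inscribed_lengths_eq bdd_above_def)
  show ?thesis
  proof (rule bdd_aboveI)
    fix s assume s: "s \<in> partition_sums g a b"
    have "dist (g 0) (g a) + s + dist (g b) (g 1) \<in> partition_sums g 0 1"
      using assms s by (intro partition_sums_append[of _ g 0 b] partition_sums_append[of _ g 0 a]
          dist_in_partition_sums) auto
    then show "s \<le> M"
      using M[of "dist (g 0) (g a) + s + dist (g b) (g 1)"] zero_le_dist[of "g 0" "g a"]
        zero_le_dist[of "g b" "g 1"] by linarith
  qed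
qed

section \<open>Additivity and continuity of the length function\<close>

lemma variation_upper:
  assumes "rectifiable_path g" "0 \<le> a" "b \<le> 1" "s \<in> partition_sums g a b"
  shows "s \<le> variation g a b"
proof -
  have "a \<le> b" using assms(4) by (rule partition_sums_le)
  then show ?thesis
    unfolding variation_def using assms by (intro cSup_upper bdd_above_partition_sums)
qed

lemma variation_least:
  assumes "a \<le> b" "\<And>s. s \<in> partition_sums g a b \<Longrightarrow> s \<le> M"
  shows "variation g a b \<le> M"
  unfolding variation_def using assms dist_in_partition_sums[of a b g]
  by (intro cSup_least) auto

lemma dist_le_variation:
  assumes "rectifiable_path g" "0 \<le> a" "a \<le> b" "b \<le> 1"
  shows "dist (g a) (g b) \<le> variation g a b"
  using assms by (intro variation_upper dist_in_partition_sums) auto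

lemma variation_nonneg:
  assumes "rectifiable_path g" "0 \<le> a" "a \<le> b" "b \<le> 1"
  shows "0 \<le> variation g a b"
  by (rule order_trans[OF zero_le_dist dist_le_variation[OF assms]])

lemma variation_add:
  assumes "rectifiable_path g" "0 \<le> a" "a \<le> b" "b \<le> c" "c \<le> 1"
  shows "variation g a c = variation g a b + variation g b c"
proof (rule antisym)
  show "variation g a c \<le> variation g a b + variation g b c"
  proof (rule variation_least)
    fix s assume "s \<in> partition_sums g a c"
    then obtain r1 r2 where "r1 \<in> partition_sums g a b" "r2 \<in> partition_sums g b c" "s \<le> r1 + r2"
      by (rule partition_sums_split[where b = b]) (use assms in auto)
    then show "s \<le> variation g a b + variation g b c"
      using variation_upper[of g a b r1] variation_upper[of g b c r2] assms by linarith
  qed (use assms in auto)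
  \<comment> \<open>For superadditivity, fix a sum on \<open>{a..b}\<close>, take the supremum over
    the sums on \<open>{b..c}\<close>, and only then the supremum over the first sum.\<close>
  have "variation g a b \<le> variation g a c - variation g b c"
  proof (rule variation_least)
    fix r assume r: "r \<in> partition_sums g a b"
    have "variation g b c \<le> variation g a c - r"
    proof (rule variation_least)
      fix s assume "s \<in> partition_sums g b c"
      then show "s \<le> variation g a c - r"
        using variation_upper[of g a c "r + s"] partition_sums_append[OF r] assms by simp
    qed (use assms in auto)
    then show "r \<le> variation g a c - variation g b c" by simp
  qed (use assms in auto)
  then show "variation g a b + variation g b c \<le> variation g a c" by simp
qed

text \<open>Fix a partition with \<open>n\<close> cells that is within \<open>\<epsilon>\<close> of the full length. Truncated to a
  short interval it has at most \<open>n\<close> cells, each of small oscillation.\<close>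

lemma variation_small:
  assumes g: "rectifiable_path g" and "\<epsilon> > 0"
  obtains \<eta> where "\<eta> > 0" "\<And>u v. 0 \<le> u \<Longrightarrow> u \<le> v \<Longrightarrow> v \<le> 1 \<Longrightarrow> v - u < \<eta> \<Longrightarrow> variation g u v < \<epsilon>"
proof -
  have "variation g 0 1 - \<epsilon> / 2 < Sup (partition_sums g 0 1)"
    using \<open>\<epsilon> > 0\<close> by (simp add: variation_def)
  then obtain s where s: "s \<in> partition_sums g 0 1" "variation g 0 1 - \<epsilon> / 2 < s"
    using less_cSup_iff[of "partition_sums g 0 1"] bdd_above_partition_sums[OF g, of 0 1]
      dist_in_partition_sums[of 0 1 g] by fastforce
  obtain n t where t: "s = (\<Sum>i<n. dist (g (t i)) (g (t (Suc i))))" "t 0 = 0" "t n = 1"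
    "mono_on {..n} t" "\<And>i. i < n \<Longrightarrow> t i \<le> t (Suc i)"
    using partition_sumsD[OF s(1)] by blast
  have "uniformly_continuous_on {0..1} g"
    using g by (intro compact_uniformly_continuous) (auto simp: rectifiable_path_def path_def)
  moreover have "\<epsilon> / (2 * (real n + 1)) > 0"
    using \<open>\<epsilon> > 0\<close> by simp
  ultimately obtain \<eta> where \<eta>: "\<eta> > 0"
    "\<And>u v. u \<in> {0..1} \<Longrightarrow> v \<in> {0..1} \<Longrightarrow> dist v u < \<eta> \<Longrightarrow> dist (g v) (g u) < \<epsilon> / (2 * (real n + 1))"
    unfolding uniformly_continuous_on_def by blast
  show ?thesis
  proof (rule that[OF \<eta>(1)])
    fix u v :: real assume uv: "0 \<le> u" "u \<le> v" "v \<le> 1" "v - u < \<eta>"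
    \<comment> \<open>\<open>A\<close>, \<open>B\<close>, \<open>D\<close> are the contributions of
      \<open>{0..u}\<close>, \<open>{u..v}\<close>, \<open>{v..1}\<close>. As \<open>A\<close> and
      \<open>D\<close> are at most the corresponding variations, additivity gives
      \<open>variation g u v < B + \<epsilon> / 2\<close>.\<close>
    define A where "A = (\<Sum>i<n. dist (g (min (t i) u)) (g (min (t (Suc i)) u)))"
    define B where "B = (\<Sum>i<n. dist (g (min (max (t i) u) v)) (g (min (max (t (Suc i)) u) v)))"
    define D where "D = (\<Sum>i<n. dist (g (max (max (t i) u) v)) (g (max (max (t (Suc i)) u) v)))"
    have "s \<le> A + (B + D)"
      using partition_split[of n t g u] partition_split[of n "\<lambda>i. max (t i) u" g v] t(5)
      unfolding A_def B_def D_def t(1) by (fastforce simp: max_def)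
    moreover have "A \<le> variation g 0 u"
      unfolding A_def using t uv g by (intro variation_upper partition_sumsI mono_on_min_max) auto
    moreover have "D \<le> variation g v 1"
      unfolding D_def using t uv g by (intro variation_upper partition_sumsI mono_on_min_max) auto
    moreover have "B \<le> \<epsilon> / 2"
    proof -
      \<comment> \<open>All truncated points lie in \<open>{u..v}\<close>, so the modulus
        \<open>\<eta>\<close> applies to each of the \<open>n\<close> cells; the \<open>+ 1\<close>
        keeps the denominator positive.\<close>
      have "B \<le> (\<Sum>i<n. \<epsilon> / (2 * (real n + 1)))"
        unfolding B_def
        by (intro sum_mono less_imp_le \<eta>(2)) (use uv in \<open>auto simp: dist_real_def min_def max_def\<close>)
      also have "\<dots> \<le> \<epsilon> / 2"
        using \<open>\<epsilon> > 0\<close> by (simp add: field_simps)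
      finally show ?thesis .
    qed
    moreover have "variation g 0 1 = variation g 0 u + variation g u v + variation g v 1"
      using variation_add[OF g, of 0 u v] variation_add[OF g, of 0 v 1] uv by simp
    ultimately show "variation g u v < \<epsilon>"
      using s(2) by linarith
  qed
qed

lemma continuous_on_variation:
  assumes g: "rectifiable_path g"
  shows "continuous_on {0..1} (variation g 0)"
  unfolding continuous_on_iff
proof (intro ballI allI impI)
  fix x \<epsilon> :: real assume "x \<in> {0..1}" "\<epsilon> > 0"
  obtain \<eta> where \<eta>: "\<eta> > 0" "\<And>u v. 0 \<le> u \<Longrightarrow> u \<le> v \<Longrightarrow> v \<le> 1 \<Longrightarrow> v - u < \<eta> \<Longrightarrow> variation g u v < \<epsilon>"
    using variation_small[OF g \<open>\<epsilon> > 0\<close>] by blast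
  have *: "dist (variation g 0 u) (variation g 0 v) < \<epsilon>" if "0 \<le> u" "u \<le> v" "v \<le> 1" "v - u < \<eta>" for u v
    using that \<eta>(2)[of u v] variation_add[OF g, of 0 u v] variation_nonneg[OF g, of u v]
    by (simp add: dist_real_def)
  show "\<exists>d>0. \<forall>x'\<in>{0..1}. dist x' x < d \<longrightarrow> dist (variation g 0 x') (variation g 0 x) < \<epsilon>"
  proof (intro exI[of _ \<eta>] conjI ballI impI \<eta>(1))
    fix x' assume "x' \<in> {0..1}" "dist x' x < \<eta>"
    then show "dist (variation g 0 x') (variation g 0 x) < \<epsilon>"
      using *[of x x'] *[of x' x] \<open>x \<in> {0..1}\<close>
      by (cases "x \<le> x'") (auto simp: dist_commute dist_real_def)
  qed
qed

lemma variation_refl [simp]: "variation g a a = 0"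
  using partition_sums_const[of a a g "g a"] by (simp add: variation_def)

lemma variation_onto:
  assumes "rectifiable_path g" "s \<in> {0..arclength g}"
  obtains t where "t \<in> {0..1}" "variation g 0 t = s"
  using IVT'[of "variation g 0" 0 s 1] continuous_on_variation[OF assms(1)] assms(2)
  by (auto simp: arclength_eq)

lemma variation_in_range:
  assumes "rectifiable_path g" "t \<in> {0..1}"
  shows "variation g 0 t \<in> {0..arclength g}"
  using assms variation_add[of g 0 t 1] variation_nonneg[of g 0 t] variation_nonneg[of g t 1]
  by (auto simp: arclength_eq)

text \<open>Parameters with the same length value therefore have the same image, so \<open>g\<close>
  factors through its length function. This makes \<open>arclength_param\<close> independent of the
  choice in \<open>inv_into\<close>, and 1-Lipschitz.\<close>

lemma dist_le_variation_diff:
  assumes "rectifiable_path g" "u \<in> {0..1}" "v \<in> {0..1}"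
  shows "dist (g u) (g v) \<le> \<bar>variation g 0 u - variation g 0 v\<bar>"
  using assms variation_add[of g 0 u v] variation_add[of g 0 v u]
    dist_le_variation[of g u v] dist_le_variation[of g v u]
  by (cases "u \<le> v") (auto simp: dist_commute)

section \<open>Parametrization by arclength\<close>

lemma arclength_subpath:
  assumes "a \<le> b"
  shows "arclength (subpath a b g) = variation g a b"
  using partition_sums_subpath[OF assms, of 0 1 g] by (simp add: arclength_eq variation_def)

lemma arclength_param_alt:
  assumes "rectifiable_path g" "s \<in> {0..arclength g}"
  obtains t where "t \<in> {0..1}" "variation g 0 t = s" "arclength_param g s = g t"
proof -
  define t where "t = inv_into {0..1} (\<lambda>t. arclength (subpath 0 t g)) s"
  obtain u where "u \<in> {0..1}" "variation g 0 u = s"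
    using variation_onto[OF assms] .
  then have "s \<in> (\<lambda>t. arclength (subpath 0 t g)) ` {0..1}"
    by (intro image_eqI[of _ _ u]) (auto simp: arclength_subpath)
  from inv_into_into[OF this] f_inv_into_f[OF this] have "t \<in> {0..1}" "variation g 0 t = s"
    by (auto simp: t_def arclength_subpath)
  then show ?thesis using that[of t] by (simp add: arclength_param_def t_def)
qed

lemma arclength_param_variation:
  assumes "rectifiable_path g" "t \<in> {0..1}"
  shows "arclength_param g (variation g 0 t) = g t"
proof -
  obtain u where "u \<in> {0..1}" "variation g 0 u = variation g 0 t"
    "arclength_param g (variation g 0 t) = g u"
    using arclength_param_alt[OF assms(1) variation_in_range[OF assms]] .
  then show ?thesis
    using dist_le_variation_diff[OF assms(1), of u t] assms(2) by simp
qed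

lemma arclength_param_lipschitz:
  assumes "rectifiable_path g" "u \<in> {0..arclength g}" "v \<in> {0..arclength g}"
  shows "dist (arclength_param g u) (arclength_param g v) \<le> \<bar>u - v\<bar>"
proof -
  obtain a where "a \<in> {0..1}" "variation g 0 a = u" "arclength_param g u = g a"
    using arclength_param_alt[OF assms(1,2)] .
  moreover obtain b where "b \<in> {0..1}" "variation g 0 b = v" "arclength_param g v = g b"
    using arclength_param_alt[OF assms(1,3)] .
  ultimately show ?thesis
    using dist_le_variation_diff[OF assms(1), of a b] by simp
qed

lemma arclength_param_in_image:
  assumes "rectifiable_path g" "s \<in> {0..arclength g}"
  shows "arclength_param g s \<in> path_image g"
  by (rule arclength_param_alt[OF assms]) (simp add: path_image_def)

lemma arclength_param_ends:
  assumes "rectifiable_path g"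
  shows "arclength_param g 0 = pathstart g" "arclength_param g (arclength g) = pathfinish g"
  using arclength_param_variation[OF assms, of 0] arclength_param_variation[OF assms, of 1]
  by (auto simp: arclength_eq pathstart_def pathfinish_def)

lemma continuous_on_arclength_param:
  assumes "rectifiable_path g"
  shows "continuous_on {0..arclength g} (arclength_param g)"
proof (rule lipschitz_on_continuous_on)
  show "1-lipschitz_on {0..arclength g} (arclength_param g)"
    using arclength_param_lipschitz[OF assms] by (intro lipschitz_onI) (auto simp: dist_real_def)
qed

text \<open>The length function maps \<open>{0..1}\<close> onto \<open>{0..arclength g}\<close>, so
  a factorization of \<open>g\<close> through it is unique. This criterion identifies the
  parametrizations of subpaths and of paths that agree on \<open>{0..1}\<close>.\<close>

lemma arclength_param_unique:
  assumes "rectifiable_path g" "s \<in> {0..arclength g}"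
    and "\<And>t. t \<in> {0..1} \<Longrightarrow> q (variation g 0 t) = g t"
  shows "arclength_param g s = q s"
  by (rule arclength_param_alt[OF assms(1,2)]) (use assms(3) in force)

lemma rectifiable_path_subpath:
  assumes "rectifiable_path g" "0 \<le> a" "a \<le> b" "b \<le> 1"
  shows "rectifiable_path (subpath a b g)"
  using assms bdd_above_partition_sums[OF assms] partition_sums_subpath[OF assms(3), of 0 1 g]
  by (auto simp: rectifiable_path_def inscribed_lengths_eq intro: path_subpath)

lemma arclength_param_subpath:
  assumes g: "rectifiable_path g" and ab: "0 \<le> a" "a \<le> b" "b \<le> 1"
    and s: "s \<in> {0..variation g a b}"
  shows "arclength_param (subpath a b g) s = arclength_param g (variation g 0 a + s)"
proof (rule arclength_param_unique)
  show "rectifiable_path (subpath a b g)" using g ab by (rule rectifiable_path_subpath)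
  show "s \<in> {0..arclength (subpath a b g)}" using s ab by (simp add: arclength_subpath)
  fix t :: real assume t: "t \<in> {0..1}"
  define u where "u = (b - a) * t + a"
  have "(b - a) * t \<le> (b - a) * 1" using t ab by (intro mult_left_mono) auto
  then have u: "a \<le> u" "u \<le> b" using t ab by (auto simp: u_def)
  have "variation (subpath a b g) 0 t = variation g a u"
    using partition_sums_subpath[OF ab(2), of 0 t g] t by (simp add: variation_def u_def)
  then have "variation g 0 a + variation (subpath a b g) 0 t = variation g 0 u"
    using variation_add[OF g, of 0 a u] ab u by simp
  then show "arclength_param g (variation g 0 a + variation (subpath a b g) 0 t) = subpath a b g t"
    using arclength_param_variation[OF g, of u] ab u by (simp add: subpath_def u_def)
qed

section \<open>Integrals with respect to arclength\<close>

lemma continuous_on_compose_arclength_param: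
  assumes "rectifiable_path g" "continuous_on (path_image g) f"
  shows "continuous_on {0..arclength g} (\<lambda>s. f (arclength_param g s))"
  using assms(1) arclength_param_in_image[OF assms(1)]
  by (intro continuous_on_compose2[OF assms(2) continuous_on_arclength_param]) auto

lemma arclength_integral_subpath:
  assumes g: "rectifiable_path g" and f: "continuous_on (path_image g) f"
    and ab: "0 \<le> a" "a \<le> b" "b \<le> 1"
  shows "arclength_integral f (subpath a b g) =
    integral {variation g 0 a..variation g 0 b} (\<lambda>s. f (arclength_param g s))"
proof -
  have ad: "variation g 0 b = variation g a b + variation g 0 a"
    using variation_add[OF g, of 0 a b] ab by simp
  have "arclength_integral f (subpath a b g) =
      integral {0..variation g a b} ((\<lambda>s. f (arclength_param g s)) \<circ> (\<lambda>s. s + variation g 0 a))"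
    unfolding arclength_integral_def arclength_subpath[OF ab(2)]
    by (rule integral_cong) (use arclength_param_subpath[OF g ab] in \<open>auto simp: add.commute\<close>)
  also have "\<dots> = integral {0 + variation g 0 a..variation g a b + variation g 0 a}
      (\<lambda>s. f (arclength_param g s))"
    using variation_in_range[OF g, of a] variation_in_range[OF g, of b] ab ad
    by (intro integral_shift continuous_on_subset[OF continuous_on_compose_arclength_param[OF g f]]) auto
  finally show ?thesis by (simp add: ad)
qed

lemma arclength_integral_split:
  assumes g: "rectifiable_path g" and f: "continuous_on (path_image g) f" and t: "t \<in> {0..1}"
  shows "arclength_integral f g =
    arclength_integral f (subpath 0 t g) + arclength_integral f (subpath t 1 g)"
proof -
  have "(\<lambda>s. f (arclength_param g s)) integrable_on {0..arclength g}"
    by (intro integrable_continuous_real continuous_on_compose_arclength_param g f)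
  from Henstock_Kurzweil_Integration.integral_combine[OF _ _ this, of "variation g 0 t"]
  show ?thesis
    using t variation_in_range[OF g t]
    by (simp add: arclength_integral_subpath[OF g f]) (simp add: arclength_integral_def arclength_eq)
qed

text \<open>A subpath of a join recovers the corresponding piece only on \<open>{0..1}\<close>, not
  as a function on the reals, so agreement there has to suffice.\<close>

lemma arclength_integral_cong_path:
  assumes g: "rectifiable_path g" and eq: "\<And>t. t \<in> {0..1} \<Longrightarrow> g t = h t"
  shows "arclength_integral f g = arclength_integral f h"
proof -
  have var: "variation h 0 t = variation g 0 t" if "t \<in> {0..1}" for t
    using partition_sums_cong[of 0 t g h] eq that by (simp add: variation_def)
  have h: "rectifiable_path h"
    using g eq partition_sums_cong[of 0 1 g h] continuous_on_cong[of "{0..1}" "{0..1}" g h]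
    by (auto simp: rectifiable_path_def path_def inscribed_lengths_eq)
  have "arclength_param g s = arclength_param h s" if "s \<in> {0..arclength g}" for s
  proof (rule arclength_param_unique[OF g that])
    show "arclength_param h (variation g 0 t) = g t" if "t \<in> {0..1}" for t
      using arclength_param_variation[OF h that] var[OF that] eq[OF that] by simp
  qed
  then show ?thesis
    using var[of 1] by (auto simp: arclength_integral_def arclength_eq intro!: integral_cong)
qed

lemma subpath_joinpaths:
  assumes "pathfinish g = pathstart h" "t \<in> {0..1}"
  shows "subpath 0 (1/2) (g +++ h) t = g t" "subpath (1/2) 1 (g +++ h) t = h t"
  using assms by (auto simp: subpath_def joinpaths_def pathfinish_def pathstart_def)

lemma rectifiable_path_join:
  fixes g h :: "real \<Rightarrow> 'a::real_normed_vector"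
  assumes g: "rectifiable_path g" and h: "rectifiable_path h" and eq: "pathfinish g = pathstart h"
  shows "rectifiable_path (g +++ h)"
proof -
  have 1: "partition_sums (g +++ h) 0 (1/2) = partition_sums g 0 1"
    using partition_sums_subpath[of 0 "1/2" 0 1 "g +++ h"]
      partition_sums_cong[of 0 1 "subpath 0 (1/2) (g +++ h)" g] subpath_joinpaths[OF eq] by simp
  have 2: "partition_sums (g +++ h) (1/2) 1 = partition_sums h 0 1"
    using partition_sums_subpath[of "1/2" 1 0 1 "g +++ h"]
      partition_sums_cong[of 0 1 "subpath (1/2) 1 (g +++ h)" h] subpath_joinpaths[OF eq] by simp
  have "bdd_above (partition_sums (g +++ h) 0 1)"
  proof (rule bdd_aboveI)
    fix s assume "s \<in> partition_sums (g +++ h) 0 1"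
    then obtain r1 r2 where "r1 \<in> partition_sums g 0 1" "r2 \<in> partition_sums h 0 1" "s \<le> r1 + r2"
      by (rule partition_sums_split[where b = "1/2"]) (auto simp: 1 2)
    then show "s \<le> variation g 0 1 + variation h 0 1"
      using variation_upper[OF g, of 0 1 r1] variation_upper[OF h, of 0 1 r2] by simp
  qed
  then show ?thesis
    using g h eq by (simp add: rectifiable_path_def inscribed_lengths_eq)
qed

lemma arclength_integral_join:
  assumes g: "rectifiable_path g" and h: "rectifiable_path h" and eq: "pathfinish g = pathstart h"
    and f: "continuous_on (path_image g \<union> path_image h) f"
  shows "arclength_integral f (g +++ h) = arclength_integral f g + arclength_integral f h"
proof -
  have gh: "rectifiable_path (g +++ h)" using g h eq by (rule rectifiable_path_join)
  have "arclength_integral f g = arclength_integral f (subpath 0 (1/2) (g +++ h))"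
    "arclength_integral f h = arclength_integral f (subpath (1/2) 1 (g +++ h))"
    using subpath_joinpaths[OF eq] by (auto intro!: arclength_integral_cong_path g h)
  then show ?thesis
    using arclength_integral_split[OF gh, of f "1/2"] f eq by (simp add: path_image_join)
qed

lemma arclength_integral_nonneg:
  assumes "rectifiable_path g" "\<And>z. z \<in> path_image g \<Longrightarrow> 0 \<le> f z"
  shows "0 \<le> arclength_integral f g"
proof (cases "(\<lambda>s. f (arclength_param g s)) integrable_on {0..arclength g}")
  case True
  then show ?thesis
    unfolding arclength_integral_def
    by (rule integral_nonneg) (rule assms(2) arclength_param_in_image assms(1) | assumption)+
next
  case False
  \<comment> \<open>The integral of a non-integrable function is 0 by convention.\<close>
  then show ?thesis
    by (simp add: arclength_integral_def not_integrable_integral)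
qed

text \<open>On a segment the chord length is proportional to the parameter difference, so every
  inscribed sum telescopes to the same value.\<close>

lemma linepath_rectifiable:
  fixes x y :: "'a::real_normed_vector"
  shows "rectifiable_path (linepath x y)" "arclength (linepath x y) = dist x y"
proof -
  have d: "dist (linepath x y u) (linepath x y v) = \<bar>v - u\<bar> * dist x y" for u v
  proof -
    have "linepath x y u - linepath x y v = (v - u) *\<^sub>R (x - y)"
      by (simp add: linepath_def algebra_simps)
    then show ?thesis by (simp add: dist_norm)
  qed
  have "s = dist x y" if s: "s \<in> partition_sums (linepath x y) 0 1" for s
  proof -
    obtain n t where t: "s = (\<Sum>i<n. dist (linepath x y (t i)) (linepath x y (t (Suc i))))"
      "t 0 = 0" "t n = 1" "\<And>i. i < n \<Longrightarrow> t i \<le> t (Suc i)"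
      using partition_sumsD[OF s] by blast
    have "s = (\<Sum>i<n. t (Suc i) - t i) * dist x y"
      unfolding t(1) sum_distrib_right using t(4) by (intro sum.cong) (auto simp: d)
    then show ?thesis using t by (simp add: sum_lessThan_telescope)
  qed
  then have "partition_sums (linepath x y) 0 1 \<subseteq> {dist x y}"
    by blast
  moreover have "dist x y \<in> partition_sums (linepath x y) 0 1"
    using dist_in_partition_sums[of 0 1 "linepath x y"] by (simp add: linepath_0' linepath_1')
  ultimately have "partition_sums (linepath x y) 0 1 = {dist x y}"
    by blast
  then show "rectifiable_path (linepath x y)" "arclength (linepath x y) = dist x y"
    by (auto simp: rectifiable_path_def inscribed_lengths_eq arclength_eq variation_def)
qed

subsection \<open>Arcs with controlled boundary distance\<close>

text \<open>The level set is nonempty and compact, hence has a least element; a value above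
  \<open>R\<close> before it would force an earlier crossing by the intermediate value
  theorem.\<close>

lemma first_hit:
  fixes f :: "real \<Rightarrow> real"
  assumes "continuous_on {a..b} f" "a \<le> b" "f a \<le> R" "R \<le> f b"
  obtains w where "w \<in> {a..b}" "f w = R" "\<And>t. t \<in> {a..w} \<Longrightarrow> f t \<le> R"
proof -
  define S where "S = {t \<in> {a..b}. f t = R}"
  have S_ne: "S \<noteq> {}"
    using IVT'[of f a R b] assms by (auto simp: S_def)
  have "closed S"
    unfolding S_def using continuous_closed_preimage_constant[OF assms(1)] by simp
  then have "compact S"
    by (rule compact_Int_closed[of "{a..b}", THEN back_subst[of compact], rotated])
      (auto simp: S_def)
  then obtain w where w: "w \<in> S" "\<And>t. t \<in> S \<Longrightarrow> w \<le> t"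
    using compact_attains_inf[OF _ S_ne] by blast
  show ?thesis
  proof (rule that)
    show "w \<in> {a..b}" "f w = R" using w(1) by (auto simp: S_def)
    fix t assume t: "t \<in> {a..w}"
    show "f t \<le> R"
    proof (rule ccontr)
      assume "\<not> f t \<le> R"
      moreover have "continuous_on {a..t} f"
        using t \<open>w \<in> {a..b}\<close> by (intro continuous_on_subset[OF assms(1)]) auto
      ultimately obtain u where u: "u \<in> {a..t}" "f u = R"
        using IVT'[of f a R t] assms t by auto
      then have "w \<le> u" using w(2) t \<open>w \<in> {a..b}\<close> by (auto simp: S_def)
      then have "t = w" using u t by auto
      then show False using \<open>\<not> f t \<le> R\<close> \<open>f w = R\<close> by simp
    qed
  qed
qed

text \<open>Models a geodesic of length \<open>\<Lambda>\<close> parametrized by arclength: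
  \<open>p\<close> is the parametrization, \<open>f\<close> the boundary distance along it, and
  \<open>C\<close> stands for \<open>c\<^sub>\<phi>\<close>. \<open>arc_bound\<close> is hypothesis
  (i) combined with minimality of subarcs. The abstraction makes the reversed geodesic another
  instance.\<close>

locale admissible_arc =
  fixes p :: "real \<Rightarrow> 'a::metric_space" and f :: "real \<Rightarrow> real" and \<phi> :: "real \<Rightarrow> real"
    and \<Lambda> \<delta> c C :: real
  assumes p_lip: "\<lbrakk>u \<in> {0..\<Lambda>}; v \<in> {0..\<Lambda>}\<rbrakk> \<Longrightarrow> dist (p u) (p v) \<le> \<bar>u - v\<bar>"
    and f_pos: "u \<in> {0..\<Lambda>} \<Longrightarrow> 0 < f u"
    and f_lip: "\<lbrakk>u \<in> {0..\<Lambda>}; v \<in> {0..\<Lambda>}\<rbrakk> \<Longrightarrow> \<bar>f u - f v\<bar> \<le> \<bar>u - v\<bar>"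
    and phi_mono: "mono_on {0..} \<phi>"
    and const: "2 \<le> c" "c \<le> C"
    and phi_le: "C \<le> t \<Longrightarrow> 1 + \<phi> t \<le> t / (2 * c)"
    and arc_bound: "\<lbrakk>0 \<le> u; u \<le> v; v \<le> \<Lambda>; dist (p u) (p v) < \<delta>\<rbrakk> \<Longrightarrow>
      integral {u..v} (\<lambda>s. 1 / f s) \<le>
        c * (1 + 1/2 * (\<phi> (dist (p u) (p v) / f u) + \<phi> (dist (p u) (p v) / f v)))"
begin

abbreviation K :: "real \<Rightarrow> real \<Rightarrow> real" where
  "K u v \<equiv> integral {u..v} (\<lambda>s. 1 / f s)"

lemma K_reflect: "integral {u..v} (\<lambda>s. 1 / f (\<Lambda> - s)) = K (\<Lambda> - v) (\<Lambda> - u)"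
proof -
  have "integral {u..v} (\<lambda>s. 1 / f (\<Lambda> - s)) = integral {u - \<Lambda>..v - \<Lambda>} (\<lambda>s. 1 / f (- s))"
    using integral_shift_real_ivl[of "u - \<Lambda>" "- \<Lambda>" "v - \<Lambda>" "\<lambda>s. 1 / f (- s)"] by simp
  also have "\<dots> = K (\<Lambda> - v) (\<Lambda> - u)"
    using Henstock_Kurzweil_Integration.integral_reflect_real[of "\<Lambda> - u" "\<Lambda> - v" "\<lambda>s. 1 / f s"] by simp
  finally show ?thesis .
qed

text \<open>Reversing the orientation preserves all assumptions, so each one-sided estimate below
  also yields its mirror image.\<close>

lemma reflect: "admissible_arc (\<lambda>s. p (\<Lambda> - s)) (\<lambda>s. f (\<Lambda> - s)) \<phi> \<Lambda> \<delta> c C"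
proof
  fix u v assume uv: "0 \<le> u" "u \<le> v" "v \<le> \<Lambda>" "dist (p (\<Lambda> - u)) (p (\<Lambda> - v)) < \<delta>"
  show "integral {u..v} (\<lambda>s. 1 / f (\<Lambda> - s)) \<le> c * (1 + 1/2 *
      (\<phi> (dist (p (\<Lambda> - u)) (p (\<Lambda> - v)) / f (\<Lambda> - u)) + \<phi> (dist (p (\<Lambda> - u)) (p (\<Lambda> - v)) / f (\<Lambda> - v))))"
    using arc_bound[of "\<Lambda> - v" "\<Lambda> - u"] uv by (simp add: K_reflect dist_commute add.commute)
next
  fix u v assume "u \<in> {0..\<Lambda>}" "v \<in> {0..\<Lambda>}"
  then show "dist (p (\<Lambda> - u)) (p (\<Lambda> - v)) \<le> \<bar>u - v\<bar>" "\<bar>f (\<Lambda> - u) - f (\<Lambda> - v)\<bar> \<le> \<bar>u - v\<bar>"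
    using p_lip[of "\<Lambda> - u" "\<Lambda> - v"] f_lip[of "\<Lambda> - u" "\<Lambda> - v"] by auto
qed (use f_pos phi_mono const phi_le in auto)

section \<open>Continuity of \<open>f\<close> and elementary bounds for \<open>K\<close>\<close>

lemma continuous_f: "continuous_on {0..\<Lambda>} f"
proof (rule lipschitz_on_continuous_on)
  show "1-lipschitz_on {0..\<Lambda>} f"
    using f_lip by (intro lipschitz_onI) (auto simp: dist_real_def)
qed

lemma continuous_f_sub: "0 \<le> a \<Longrightarrow> b \<le> \<Lambda> \<Longrightarrow> continuous_on {a..b} f"
  by (rule continuous_on_subset[OF continuous_f]) auto

lemma integrable_inverse:
  assumes "0 \<le> u" "v \<le> \<Lambda>"
  shows "(\<lambda>s. 1 / f s) integrable_on {u..v}"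
proof -
  have "f s \<noteq> 0" if "s \<in> {u..v}" for s
    using f_pos[of s] that assms by auto
  then show ?thesis
    by (intro integrable_continuous_real continuous_intros continuous_f_sub assms) auto
qed

lemma K_mono:
  assumes "0 \<le> a" "a \<le> u" "v \<le> b" "b \<le> \<Lambda>"
  shows "K u v \<le> K a b"
  using assms integrable_inverse f_pos by (intro integral_subset_le) (auto simp: less_imp_le)

lemma K_ge:
  assumes "0 \<le> u" "u \<le> v" "v \<le> \<Lambda>" "\<And>s. s \<in> {u..v} \<Longrightarrow> f s \<le> R"
  shows "(v - u) / R \<le> K u v"
proof -
  have "K u v \<ge> integral {u..v} (\<lambda>s. 1 / R)"
    using assms integrable_inverse f_pos
    by (intro integral_le) (auto intro!: frac_le)
  then show ?thesis using assms by simp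
qed

lemma dist_phi_mono:
  assumes "u \<in> {0..\<Lambda>}" "v \<in> {0..\<Lambda>}" "w \<in> {0..\<Lambda>}" "dist (p u) (p v) / f w \<le> t"
  shows "\<phi> (dist (p u) (p v) / f w) \<le> \<phi> t"
proof (rule mono_onD[OF phi_mono])
  have "0 \<le> dist (p u) (p v) / f w" using f_pos[of w] assms by simp
  then show "dist (p u) (p v) / f w \<in> {0..}" "t \<in> {0..}" using assms(4) by auto
qed (rule assms(4))

text \<open>Both ratios \<open>(v - u) / f u\<close> and \<open>(v - u) / f v\<close> are at least
  \<open>C\<close>, so \<open>phi_le\<close> applies at both ends. In the average the additive
  constants cancel and the denominator \<open>2 * c\<close> absorbs the factor
  \<open>c\<close>.\<close>

lemma K_le_trapezoid:
  assumes uv: "0 \<le> u" "u \<le> v" "v \<le> \<Lambda>" "v - u < \<delta>" and L: "C * f u \<le> v - u" "C * f v \<le> v - u"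
  shows "K u v \<le> (v - u) / 4 * (1 / f u + 1 / f v)"
proof -
  have pos: "0 < f u" "0 < f v" using uv f_pos by auto
  have d: "dist (p u) (p v) \<le> v - u" using p_lip[of u v] uv by auto
  have "\<phi> (dist (p u) (p v) / f w) \<le> (v - u) / f w / (2 * c) - 1" if w: "w = u \<or> w = v" for w
  proof -
    have "\<phi> (dist (p u) (p v) / f w) \<le> \<phi> ((v - u) / f w)"
      using w uv d pos by (intro dist_phi_mono) (auto intro!: divide_right_mono)
    also have "1 + \<phi> ((v - u) / f w) \<le> (v - u) / f w / (2 * c)"
      using w L pos by (intro phi_le) (auto simp: pos_le_divide_eq)
    finally show ?thesis by simp
  qed
  moreover have "1 + 1/2 * (a + b) \<le> 1 + 1/2 * (a' + b')" if "a \<le> a'" "b \<le> b'" for a b a' b' :: real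
    using that by simp
  ultimately have
    "1 + 1/2 * (\<phi> (dist (p u) (p v) / f u) + \<phi> (dist (p u) (p v) / f v)) \<le>
      1 + 1/2 * (((v - u) / f u / (2 * c) - 1) + ((v - u) / f v / (2 * c) - 1))"
    by blast
  also have "\<dots> = (v - u) / 4 * (1 / f u + 1 / f v) / c"
    using pos const by (simp add: field_simps)
  finally have "c * (1 + 1/2 * (\<phi> (dist (p u) (p v) / f u) + \<phi> (dist (p u) (p v) / f v))) \<le>
      (v - u) / 4 * (1 / f u + 1 / f v)"
    using const by (simp add: field_simps)
  then show ?thesis using arc_bound[of u v] uv d by linarith
qed

text \<open>The maximum gives \<open>K \<tau> v \<ge> (v - \<tau>) / f \<tau>\<close>. If
  \<open>f v\<close> exceeded \<open>f \<tau> / 3\<close>, the trapezoid bound would be strictly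
  below \<open>(1 + 3) / 4\<close> times the same quantity; this is where the third comes
  from.\<close>

lemma decay_right:
  assumes "0 \<le> \<tau>" "\<tau> \<le> b" "b \<le> \<Lambda>" "b - \<tau> < \<delta>" and max: "\<And>s. s \<in> {\<tau>..b} \<Longrightarrow> f s \<le> f \<tau>"
    and v: "v \<le> b" "\<tau> + C * f \<tau> \<le> v"
  shows "f v \<le> f \<tau> / 3"
proof (rule ccontr)
  assume "\<not> f v \<le> f \<tau> / 3"
  have C: "0 < C" using const by simp
  have pos: "0 < f \<tau>" using f_pos assms by auto
  then have "0 < C * f \<tau>" using C by simp
  then have lt: "\<tau> < v" using v by simp
  have posv: "0 < f v" "f v \<le> f \<tau>" using f_pos[of v] max[of v] assms lt by auto
  have "C * f v \<le> v - \<tau>"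
    using posv v C mult_left_mono[of "f v" "f \<tau>" C] by linarith
  then have "K \<tau> v \<le> (v - \<tau>) / 4 * (1 / f \<tau> + 1 / f v)"
    using assms lt by (intro K_le_trapezoid) auto
  also have "\<dots> < (v - \<tau>) / 4 * (1 / f \<tau> + 3 / f \<tau>)"
    using lt pos posv \<open>\<not> f v \<le> f \<tau> / 3\<close>
    by (intro mult_strict_left_mono add_strict_left_mono) (auto simp: field_simps)
  also have "\<dots> = (v - \<tau>) / f \<tau>" using pos by (simp add: field_simps)
  also have "\<dots> \<le> K \<tau> v" using assms lt by (intro K_ge) auto
  finally show False by simp
qed

lemma decay_left:
  assumes "0 \<le> a" "a \<le> \<tau>" "\<tau> \<le> \<Lambda>" "\<tau> - a < \<delta>" and max: "\<And>s. s \<in> {a..\<tau>} \<Longrightarrow> f s \<le> f \<tau>"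
    and v: "a \<le> v" "v \<le> \<tau> - C * f \<tau>"
  shows "f v \<le> f \<tau> / 3"
  using admissible_arc.decay_right[OF reflect, of "\<Lambda> - \<tau>" "\<Lambda> - a" "\<Lambda> - v"] assms by auto

text \<open>Around a maximum \<open>f \<tau>\<close>, beyond distance \<open>C f \<tau>\<close>, the function drops to a third of it. The longer
  side of \<open>\<tau>\<close> then violates the length bound for \<open>R / 3\<close>: at least half of more than \<open>6 C R\<close>, less
  \<open>C R\<close>, is more than \<open>6 C (R / 3)\<close>.\<close>

lemma long_low_arc_decay:
  assumes "0 \<le> a" "a \<le> b" "b \<le> \<Lambda>" "b - a < \<delta>" "6 * C * R < b - a" "\<And>s. s \<in> {a..b} \<Longrightarrow> f s \<le> R"
  shows "\<exists>s\<in>{0..\<Lambda>}. f s \<le> R / 3 ^ n"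
  using assms
proof (induction n arbitrary: a b R)
  case 0
  then show ?case by (intro bexI[of _ a]) auto
next
  case (Suc n)
  obtain \<tau> where \<tau>: "\<tau> \<in> {a..b}" "\<And>s. s \<in> {a..b} \<Longrightarrow> f s \<le> f \<tau>"
    using continuous_attains_sup[of "{a..b}" f] continuous_f_sub[of a b] Suc.prems by auto
  have C: "0 < C" using const by simp
  have R: "f \<tau> \<le> R" using Suc.prems(6) \<tau> by auto
  then have CR: "C * f \<tau> \<le> C * R" using C by simp
  have pos: "0 < f \<tau>" using f_pos \<tau> Suc.prems by auto
  then have Cpos: "0 < C * f \<tau>" using C by simp
  have "\<exists>s\<in>{0..\<Lambda>}. f s \<le> R / 3 / 3 ^ n"
  proof (cases "\<tau> \<le> (a + b) / 2")
    case True
    have "f s \<le> R / 3" if "s \<in> {\<tau> + C * f \<tau>..b}" for s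
      using decay_right[of \<tau> b s] \<tau> Suc.prems that R by force
    then show ?thesis
      using True \<tau> Suc.prems CR Cpos by (intro Suc.IH[of "\<tau> + C * f \<tau>" b]) auto
  next
    case False
    have "f s \<le> R / 3" if "s \<in> {a..\<tau> - C * f \<tau>}" for s
      using decay_left[of a \<tau> s] \<tau> Suc.prems that R by force
    then show ?thesis
      using False \<tau> Suc.prems CR Cpos by (intro Suc.IH[of a "\<tau> - C * f \<tau>"]) auto
  qed
  then show ?case by (simp add: field_simps)
qed

text \<open>A longer arc would contain points with \<open>f \<le> R / 3 ^ n\<close> for every
  \<open>n\<close>, but \<open>f\<close> has a positive minimum on the compact interval
  \<open>{0..\<Lambda>}\<close>.\<close>

lemma low_arc_short:
  assumes ab: "0 \<le> a" "a \<le> b" "b \<le> \<Lambda>" and R: "6 * C * R < \<delta>" "\<And>s. s \<in> {a..b} \<Longrightarrow> f s \<le> R"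
  shows "b - a \<le> 6 * C * R"
proof (rule ccontr)
  assume long: "\<not> b - a \<le> 6 * C * R"
  \<comment> \<open>The decay argument needs an arc shorter than \<open>\<delta>\<close> but still
    longer than \<open>6 * C * R\<close>; the midpoint of these two numbers is a suitable truncation
    length.\<close>
  define b' where "b' = min b (a + (6 * C * R + \<delta>) / 2)"
  have b': "a \<le> b'" "b' \<le> b" "b' - a < \<delta>" "6 * C * R < b' - a"
  proof -
    have "0 < f a" "f a \<le> R" using f_pos[of a] R(2)[of a] ab by auto
    then have "0 < C * R" using const by simp
    then show "a \<le> b'" "b' \<le> b" "b' - a < \<delta>" "6 * C * R < b' - a"
      using ab R(1) long by (auto simp: b'_def min_def field_simps)
  qed
  obtain z where z: "z \<in> {0..\<Lambda>}" "\<And>s. s \<in> {0..\<Lambda>} \<Longrightarrow> f z \<le> f s"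
    using continuous_attains_inf[OF _ _ continuous_f] ab by auto
  have "0 < f z" using z f_pos by auto
  have "(\<lambda>n. R * (1/3) ^ n) \<longlonglongrightarrow> R * 0"
    by (intro tendsto_intros) auto
  from order_tendstoD(2)[OF this, of "f z"] \<open>0 < f z\<close> obtain n where n: "R * (1/3) ^ n < f z"
    by (auto simp: eventually_sequentially)
  obtain s where "s \<in> {0..\<Lambda>}" "f s \<le> R / 3 ^ n"
    using long_low_arc_decay[of a b' R n] b' ab R by auto
  then show False using z(2)[of s] n by (simp add: power_divide)
qed

text \<open>Since \<open>f\<close> grows at most at unit speed, \<open>K u v \<ge> ln (1 + (v - u) / f u)\<close>.\<close>

lemma harnack:
  assumes "0 \<le> u" "u \<le> v" "v \<le> \<Lambda>"
  shows "f u + (v - u) \<le> f u * exp (K u v)"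
proof -
  have pos: "0 < f u" using f_pos assms by auto
  have "((\<lambda>s. 1 / (f u + (s - u))) has_integral ln (f u + (v - u)) - ln (f u + (u - u))) {u..v}"
    using pos assms
    by (intro fundamental_theorem_of_calculus)
      (auto intro!: derivative_eq_intros simp flip: has_real_derivative_iff_has_vector_derivative)
  moreover have "1 / (f u + (s - u)) \<le> 1 / f s" if "s \<in> {u..v}" for s
    using f_pos[of s] f_lip[of u s] pos that assms by (intro frac_le) auto
  ultimately have "ln (f u + (v - u)) - ln (f u + (u - u)) \<le> K u v"
    using integrable_inverse[of u v] assms by (intro has_integral_le[OF _ integrable_integral]) auto
  then have "ln (f u + (v - u)) \<le> ln (f u * exp (K u v))"
    using pos by (simp add: ln_mult)
  then show ?thesis
    using pos assms by (subst (asm) ln_le_cancel_iff) auto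
qed

lemma harnack':
  assumes "0 \<le> u" "u \<le> v" "v \<le> \<Lambda>"
  shows "f v + (v - u) \<le> f v * exp (K u v)"
  using admissible_arc.harnack[OF reflect, of "\<Lambda> - v" "\<Lambda> - u"] assms by (simp add: K_reflect)

text \<open>Let \<open>R\<close> be the maximum of \<open>f\<close> on \<open>{0..s}\<close>,
  attained at \<open>z1\<close>, and \<open>z2\<close> the first point from \<open>s\<close> on
  where \<open>f\<close> returns to \<open>R\<close>. The arc up to \<open>z2\<close> is low, so
  \<open>s \<le> 6 * C * R\<close>. It remains to compare \<open>R\<close> with \<open>f s\<close>:
  \<open>z1\<close> and \<open>z2\<close> turn out to be so close that
  \<open>K z1 z2 \<le> C / 2\<close>.\<close>

lemma cigar_left:
  assumes s: "0 \<le> s" "s \<le> a" "a \<le> \<Lambda>" and low: "\<And>t. t \<in> {0..a} \<Longrightarrow> f t \<le> f a" and "6 * C * f a < \<delta>"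
  shows "s \<le> 6 * C * exp (C / 2) * f s"
proof -
  have C: "0 < C" using const by simp
  obtain z1 where z1: "z1 \<in> {0..s}" "\<And>t. t \<in> {0..s} \<Longrightarrow> f t \<le> f z1"
    using continuous_attains_sup[of "{0..s}" f] continuous_f_sub[of 0 s] s by auto
  define R where "R = f z1"
  have R: "0 < R" "R \<le> f a" using z1(1) s f_pos[of z1] low[of z1] by (auto simp: R_def)
  have "6 * C * R \<le> 6 * C * f a" using R C by simp
  then have Rd: "6 * C * R < \<delta>" using assms by simp
  obtain z2 where z2: "z2 \<in> {s..a}" "f z2 = R" "\<And>t. t \<in> {s..z2} \<Longrightarrow> f t \<le> R"
    using first_hit[of s a f R] continuous_f_sub[of s a] s z1(2)[of s] R by (auto simp: R_def)
  have le: "f t \<le> R" if "t \<in> {0..z2}" for t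
    using z1(2)[of t] z2(3)[of t] that by (cases "t \<le> s") (auto simp: R_def)
  have bnd: "0 \<le> z1" "z1 \<le> s" "s \<le> z2" "z2 \<le> \<Lambda>" using z1 z2 s by auto
  define L where "L = z2 - z1"
  have "L \<le> 6 * C * R"
    unfolding L_def using bnd le Rd by (intro low_arc_short) auto
  then have Ld: "L < \<delta>" using Rd by simp
  \<comment> \<open>As \<open>f\<close> equals its maximum \<open>R\<close> at both ends, the
    trapezoid bound would be half of the lower bound for \<open>K z1 z2\<close>.\<close>
  have "L < C * R"
  proof (rule ccontr)
    assume "\<not> L < C * R"
    then have CL: "C * R \<le> L" by simp
    then have "0 < L" using R C by (smt (verit) mult_pos_pos)
    have "L / R \<le> K z1 z2" unfolding L_def using bnd le by (intro K_ge) auto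
    also have "\<dots> \<le> L / 4 * (1 / f z1 + 1 / f z2)"
      unfolding L_def using bnd Ld CL z2(2) by (intro K_le_trapezoid) (auto simp: L_def R_def)
    also have "\<dots> = L / R / 2" using z2(2) by (simp add: R_def)
    finally show False using \<open>0 < L\<close> R by (simp add: field_simps)
  qed
  have d: "dist (p z1) (p z2) \<le> L"
    using p_lip[of z1 z2] bnd by (auto simp: L_def)
  then have "dist (p z1) (p z2) / R \<le> C"
    using R \<open>L < C * R\<close> by (simp add: pos_divide_le_eq)
  then have ph: "\<phi> (dist (p z1) (p z2) / f z1) \<le> \<phi> C" "\<phi> (dist (p z1) (p z2) / f z2) \<le> \<phi> C"
    using bnd z2(2) by (auto intro!: dist_phi_mono simp: R_def)
  have "K z1 s \<le> K z1 z2" using bnd by (intro K_mono) auto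
  also have "\<dots> \<le> c * (1 + 1/2 * (\<phi> (dist (p z1) (p z2) / f z1) + \<phi> (dist (p z1) (p z2) / f z2)))"
    using bnd d Ld by (intro arc_bound) auto
  also have "\<dots> \<le> c * (1 + \<phi> C)"
    using ph const by (intro mult_left_mono) auto
  also have "\<dots> \<le> c * (C / (2 * c))"
    using phi_le[of C] const by (intro mult_left_mono) auto
  also have "\<dots> = C / 2" using const by simp
  finally have K: "K z1 s \<le> C / 2" .
  have fs: "0 < f s" using f_pos s by auto
  have "R \<le> f s * exp (K z1 s)"
    using f_lip[of z1 s] harnack'[of z1 s] bnd by (auto simp: R_def)
  also have "\<dots> \<le> f s * exp (C / 2)" using K fs by simp
  finally have "6 * C * R \<le> 6 * C * (f s * exp (C / 2))" using C by simp
  moreover have "s - 0 \<le> 6 * C * R" using bnd s le Rd by (intro low_arc_short) auto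
  ultimately show ?thesis by (simp add: algebra_simps)
qed

lemma cigar_right:
  assumes "b \<le> s" "s \<le> \<Lambda>" "0 \<le> b" and "\<And>t. t \<in> {b..\<Lambda>} \<Longrightarrow> f t \<le> f b" and "6 * C * f b < \<delta>"
  shows "\<Lambda> - s \<le> 6 * C * exp (C / 2) * f s"
  using admissible_arc.cigar_left[OF reflect, of "\<Lambda> - s" "\<Lambda> - b"] assms by auto

text \<open>The cut is the first point of level \<open>r\<close>, or the start of the arc if
  \<open>f\<close> is already at least \<open>r\<close> there. In the second case the outer arc is a
  single point, which the disjunct \<open>a = s\<close> covers.\<close>

lemma level_left:
  assumes z: "z \<in> {0..\<Lambda>}" "r \<le> f z" and d: "6 * C * r < \<delta>" "0 \<le> r"
  obtains a where "0 \<le> a" "a \<le> z" "r \<le> f a" "f a \<le> max r (f 0)" "a \<le> 6 * C * r"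
    "\<And>s. s \<in> {0..a} \<Longrightarrow> a = s \<or> s \<le> 6 * C * exp (C / 2) * f s"
proof (cases "r \<le> f 0")
  case True
  then show ?thesis using that[of 0] z d const by auto
next
  case False
  obtain a where a: "a \<in> {0..z}" "f a = r" "\<And>t. t \<in> {0..a} \<Longrightarrow> f t \<le> r"
    using first_hit[of 0 z f r] continuous_f_sub[of 0 z] z False by auto
  moreover have "a - 0 \<le> 6 * C * r"
    using a z d by (intro low_arc_short) auto
  moreover have "s \<le> 6 * C * exp (C / 2) * f s" if "s \<in> {0..a}" for s
    using that a z d by (intro cigar_left[of s a]) auto
  ultimately show ?thesis using that[of a] by auto
qed

lemma level_right:
  assumes z: "z \<in> {0..\<Lambda>}" "r \<le> f z" and d: "6 * C * r < \<delta>" "0 \<le> r"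
  obtains b where "z \<le> b" "b \<le> \<Lambda>" "r \<le> f b" "\<Lambda> - b \<le> 6 * C * r"
    "\<And>s. s \<in> {b..\<Lambda>} \<Longrightarrow> b = s \<or> \<Lambda> - s \<le> 6 * C * exp (C / 2) * f s"
proof -
  have "\<Lambda> - z \<in> {0..\<Lambda>}" "r \<le> f (\<Lambda> - (\<Lambda> - z))" using z by auto
  from admissible_arc.level_left[OF reflect this d]
  obtain a where a: "a \<le> \<Lambda> - z" "0 \<le> a" "r \<le> f (\<Lambda> - a)" "a \<le> 6 * C * r"
    "\<And>s. s \<in> {0..a} \<Longrightarrow> a = s \<or> s \<le> 6 * C * exp (C / 2) * f (\<Lambda> - s)"
    by blast
  have "\<Lambda> - a = s \<or> \<Lambda> - s \<le> 6 * C * exp (C / 2) * f s" if "s \<in> {\<Lambda> - a..\<Lambda>}" for s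
    using a(5)[of "\<Lambda> - s"] that by auto
  then show ?thesis using that[of "\<Lambda> - a"] a by auto
qed

lemma arc_bounds:
  assumes "0 \<le> \<Lambda>" and \<rho>: "0 < \<rho>" "10 * C * \<rho> < \<delta>" "dist (p 0) (p \<Lambda>) = \<rho>" and f0: "f 0 < 2 * \<rho>"
  shows "\<Lambda> \<le> 6 * C * \<rho> + 2 * \<rho> * exp (1 + 6 * C)"
    and "s \<in> {0..\<Lambda>} \<Longrightarrow> min s (\<Lambda> - s) \<le> (6 * C + exp (1 + 6 * C)) * exp (1 + 6 * C) * f s"
proof -
  \<comment> \<open>\<open>1 + 6 * C\<close> will bound the integral of \<open>1 / f\<close> over
    the middle arc, so \<open>E\<close> bounds the ratio of values of \<open>f\<close>
    there.\<close>
  define E where "E = exp (1 + 6 * C)"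
  have C: "2 \<le> C" using const by simp
  have C\<rho>: "0 < C * \<rho>" "2 * \<rho> \<le> C * \<rho>" using C \<rho> by auto
  have E1: "1 \<le> E" using C by (simp add: E_def)
  have "exp (C / 2) \<le> E" using C by (simp add: E_def)
  then have "6 * C * exp (C / 2) \<le> 6 * C * E" using C by simp
  also have "\<dots> \<le> (6 * C + E) * E" using E1 by (simp add: algebra_simps)
  finally have cE: "6 * C * exp (C / 2) \<le> (6 * C + E) * E" .
  have cigar: "l \<le> (6 * C + E) * E * f t" if "l \<le> 6 * C * exp (C / 2) * f t" "t \<in> {0..\<Lambda>}" for l t
    using that f_pos[OF that(2)] mult_right_mono[OF cE, of "f t"] by linarith
  obtain z where z: "z \<in> {0..\<Lambda>}" "\<And>s. s \<in> {0..\<Lambda>} \<Longrightarrow> f s \<le> f z"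
    using continuous_attains_sup[OF _ _ continuous_f] assms(1) by auto
  have "\<Lambda> \<le> 6 * C * \<rho> + 2 * \<rho> * E \<and>
    (\<forall>s\<in>{0..\<Lambda>}. min s (\<Lambda> - s) \<le> (6 * C + E) * E * f s)"
  proof (cases "f z < \<rho> / 2")
    case True
    then have "6 * C * f z \<le> 6 * C * (\<rho> / 2)" using C by (intro mult_left_mono) auto
    then have d: "6 * C * f z < \<delta>" "6 * C * f z \<le> 6 * C * \<rho>" using \<rho>(2) C\<rho>(1) by linarith+
    \<comment> \<open>Here the whole arc is low, and its maximum point \<open>z\<close> separates a
      left cigar from a right one.\<close>
    have "\<Lambda> - 0 \<le> 6 * C * f z" using assms(1) d z by (intro low_arc_short) auto
    then have "\<Lambda> \<le> 6 * C * \<rho> + 2 * \<rho> * E" using d \<rho> E1 by (smt (verit) mult_nonneg_nonneg)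
    moreover have "min s (\<Lambda> - s) \<le> (6 * C + E) * E * f s" if s: "s \<in> {0..\<Lambda>}" for s
    proof (cases "s \<le> z")
      case True
      then have "s \<le> 6 * C * exp (C / 2) * f s" using z s d by (intro cigar_left[of s z]) auto
      then show ?thesis using cigar[of s s] s by auto
    next
      case False
      then have "\<Lambda> - s \<le> 6 * C * exp (C / 2) * f s" using z s d by (intro cigar_right[of z s]) auto
      then show ?thesis using cigar[of "\<Lambda> - s" s] s by auto
    qed
    ultimately show ?thesis by blast
  next
    case False
    have d: "6 * C * (\<rho> / 2) < \<delta>" "0 \<le> \<rho> / 2" using \<rho>(1,2) C\<rho>(1) by auto
    have fz: "\<rho> / 2 \<le> f z" using False by simp
    obtain a where a: "0 \<le> a" "a \<le> z" "\<rho> / 2 \<le> f a" "f a \<le> max (\<rho> / 2) (f 0)" "a \<le> 6 * C * (\<rho> / 2)"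
      "\<And>s. s \<in> {0..a} \<Longrightarrow> a = s \<or> s \<le> 6 * C * exp (C / 2) * f s"
      using level_left[OF z(1) fz d] by blast
    obtain b where b: "z \<le> b" "b \<le> \<Lambda>" "\<rho> / 2 \<le> f b" "\<Lambda> - b \<le> 6 * C * (\<rho> / 2)"
      "\<And>s. s \<in> {b..\<Lambda>} \<Longrightarrow> b = s \<or> \<Lambda> - s \<le> 6 * C * exp (C / 2) * f s"
      using level_right[OF z(1) fz d] by blast
    have ab: "0 \<le> a" "a \<le> b" "b \<le> \<Lambda>" using a b by auto
    define D where "D = dist (p a) (p b)"
    have "D \<le> dist (p a) (p 0) + dist (p 0) (p \<Lambda>) + dist (p \<Lambda>) (p b)"
      unfolding D_def using dist_triangle[of "p a" "p b" "p 0"] dist_triangle[of "p 0" "p b" "p \<Lambda>"] by linarith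
    also have "\<dots> \<le> a + \<rho> + (\<Lambda> - b)"
      using p_lip[of a 0] p_lip[of \<Lambda> b] ab \<rho> assms(1) by auto
    also have "\<dots> \<le> (1 + 6 * C) * \<rho>"
      using a(5) b(4) by (simp add: algebra_simps)
    finally have D: "D \<le> (1 + 6 * C) * \<rho>" .
    \<comment> \<open>The constant 10 in the hypothesis on \<open>\<rho>\<close> leaves room for the
      two outer arcs, of length at most \<open>3 * C * \<rho>\<close> each, so that
      \<open>arc_bound\<close> applies to the cut points.\<close>
    also have "\<dots> < 10 * C * \<rho>" using C \<rho>(1) by (intro mult_strict_right_mono) auto
    finally have "D < \<delta>" using \<rho>(2) by simp
    \<comment> \<open>The doubling comes from dividing by \<open>f \<ge> \<rho> / 2\<close> at the
      cut points; the factor \<open>1 / (2 * c)\<close> in \<open>phi_le\<close> undoes it.\<close>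
    define T where "T = 2 * (1 + 6 * C)"
    have "D / f w \<le> T" if "w \<in> {a, b}" for w
    proof -
      have "D / f w \<le> (1 + 6 * C) * \<rho> / (\<rho> / 2)"
        using that a(3) b(3) \<rho> D C by (intro frac_le) auto
      then show ?thesis using \<rho> by (simp add: T_def)
    qed
    then have ph: "\<phi> (D / f a) \<le> \<phi> T" "\<phi> (D / f b) \<le> \<phi> T"
      unfolding D_def using ab by (auto intro!: dist_phi_mono)
    have "K a b \<le> c * (1 + 1/2 * (\<phi> (D / f a) + \<phi> (D / f b)))"
      unfolding D_def using ab \<open>D < \<delta>\<close> by (intro arc_bound) (auto simp: D_def)
    also have "\<dots> \<le> c * (1 + \<phi> T)" using ph const by (intro mult_left_mono) auto
    also have "\<dots> \<le> c * (T / (2 * c))"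
      using phi_le[of T] const by (intro mult_left_mono) (auto simp: T_def)
    also have "\<dots> = 1 + 6 * C" using const by (simp add: T_def)
    finally have "exp (K a b) \<le> E" by (simp add: E_def)
    \<comment> \<open>The hypothesis \<open>f 0 < 2 * \<rho>\<close> enters here: it controls
      \<open>f a\<close> when the cut is at the start of the arc.\<close>
    have fa: "0 < f a" "f a \<le> 2 * \<rho>" using f_pos[of a] ab a(4) f0 \<rho> by auto
    have "f a + (b - a) \<le> f a * exp (K a b)" using ab by (intro harnack)
    also have "\<dots> \<le> f a * E" using fa \<open>exp (K a b) \<le> E\<close> by simp
    finally have ba: "f a + (b - a) \<le> f a * E" .
    moreover have "f a * E \<le> 2 * \<rho> * E" using fa E1 by simp
    ultimately have len: "\<Lambda> \<le> 6 * C * \<rho> + 2 * \<rho> * E"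
      using a(5) b(4) fa by linarith
    have "min s (\<Lambda> - s) \<le> (6 * C + E) * E * f s" if s: "s \<in> {0..\<Lambda>}" for s
    proof -
      consider "s < a" | "b < s" | "s \<in> {a..b}" by fastforce
      then show ?thesis
      proof cases
        case 1
        then show ?thesis using a(6)[of s] s cigar[of s s] by auto
      next
        case 2
        then show ?thesis using b(5)[of s] s cigar[of "\<Lambda> - s" s] by auto
      next
        case 3
        then have fs: "0 < f s" using f_pos s by auto
        \<comment> \<open>On the middle arc \<open>s\<close> itself is bounded:
          \<open>s \<le> a + (b - a)\<close>, where \<open>a \<le> 6 * C * f a\<close> and
          \<open>b - a \<le> E * f a\<close>, while \<open>f a \<le> E * f s\<close>.\<close>
        have "f a \<le> f s * exp (K a s)"
          using f_lip[of a s] harnack'[of a s] ab 3 by auto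
        also have "\<dots> \<le> f s * E"
          using K_mono[of a a s b] ab 3 fs \<open>exp (K a b) \<le> E\<close>
          by (intro mult_left_mono order_trans[OF _ \<open>exp (K a b) \<le> E\<close>]) auto
        finally have "(6 * C + E) * f a \<le> (6 * C + E) * (f s * E)"
          using C E1 by (intro mult_left_mono) auto
        moreover have "6 * C * (\<rho> / 2) \<le> 6 * C * f a"
          using a(3) C by (intro mult_left_mono) auto
        ultimately have "s \<le> (6 * C + E) * (f s * E)"
          using 3 ba fa(1) a(5) by (simp add: algebra_simps)
        then show ?thesis by (simp add: algebra_simps)
      qed
    qed
    then show ?thesis using len by blast
  qed
  then show "\<Lambda> \<le> 6 * C * \<rho> + 2 * \<rho> * exp (1 + 6 * C)"
    and "s \<in> {0..\<Lambda>} \<Longrightarrow> min s (\<Lambda> - s) \<le> (6 * C + exp (1 + 6 * C)) * exp (1 + 6 * C) * f s"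
    by (auto simp: E_def)
qed

end

subsection \<open>Quasihyperbolic geodesics\<close>

text \<open>A nonempty frontier excludes the convention that \<open>infdist\<close> to the empty set
  is 0.\<close>

lemma boundary_dist_pos:
  assumes "open \<Omega>" "frontier \<Omega> \<noteq> {}" "z \<in> \<Omega>"
  shows "0 < boundary_dist \<Omega> z"
proof -
  have "z \<notin> frontier \<Omega>" using assms frontier_disjoint_eq by blast
  then show ?thesis
    using assms(2) infdist_pos_not_in_closed[of "frontier \<Omega>" z] by (auto simp: boundary_dist_def)
qed

lemma continuous_on_inverse_boundary_dist:
  assumes "open \<Omega>" "frontier \<Omega> \<noteq> {}"
  shows "continuous_on \<Omega> (\<lambda>z. 1 / boundary_dist \<Omega> z)"
  unfolding boundary_dist_def
  by (intro continuous_intros) (use boundary_dist_pos[OF assms] in \<open>force simp: boundary_dist_def\<close>)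

lemma boundary_dist_lipschitz: "\<bar>boundary_dist \<Omega> u - boundary_dist \<Omega> v\<bar> \<le> dist u v"
  by (simp add: boundary_dist_def infdist_triangle_abs)

lemma qh_length_nonneg: "rectifiable_path g \<Longrightarrow> 0 \<le> qh_length \<Omega> g"
  unfolding qh_length_def
  by (intro arclength_integral_nonneg) (auto simp: boundary_dist_def infdist_nonneg)

lemma qh_metric_le:
  assumes "g \<in> rectifiable_paths_between \<Omega> x y"
  shows "qh_metric \<Omega> x y \<le> qh_length \<Omega> g"
  unfolding qh_metric_def
  by (rule cINF_lower[OF _ assms], rule bdd_belowI[of _ 0])
    (auto simp: rectifiable_paths_between_def qh_length_nonneg)

text \<open>Splicing a competitor \<open>h\<close> for the subarc between the two outer pieces of
  \<open>\<gamma>\<close> gives a competitor for the whole geodesic. Subtracting the outer lengths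
  from the minimality inequality leaves the claim.\<close>

lemma geodesic_subpath_le:
  assumes \<Omega>: "open \<Omega>" "frontier \<Omega> \<noteq> {}" and geod: "qh_geodesic \<Omega> x y \<gamma>"
    and ab: "0 \<le> a" "a \<le> b" "b \<le> 1"
  shows "qh_length \<Omega> (subpath a b \<gamma>) \<le> qh_metric \<Omega> (\<gamma> a) (\<gamma> b)"
proof -
  let ?k = "\<lambda>z. 1 / boundary_dist \<Omega> z"
  have \<gamma>: "rectifiable_path \<gamma>" "path_image \<gamma> \<subseteq> \<Omega>" "pathstart \<gamma> = x" "pathfinish \<gamma> = y"
    "qh_length \<Omega> \<gamma> = qh_metric \<Omega> x y"
    using geod by (auto simp: qh_geodesic_def rectifiable_paths_between_def)
  have cont: "continuous_on A ?k" if "A \<subseteq> \<Omega>" for A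
    using continuous_on_inverse_boundary_dist[OF \<Omega>] that continuous_on_subset by blast
  have sub: "rectifiable_path (subpath u v \<gamma>)" "path_image (subpath u v \<gamma>) \<subseteq> \<Omega>"
    if "0 \<le> u" "u \<le> v" "v \<le> 1" for u v
    using that \<gamma> rectifiable_path_subpath path_image_subpath_subset[of u v \<gamma>] by auto
  have I: "qh_length \<Omega> (subpath u v \<gamma>) = integral {variation \<gamma> 0 u..variation \<gamma> 0 v} (\<lambda>s. ?k (arclength_param \<gamma> s))"
    if "0 \<le> u" "u \<le> v" "v \<le> 1" for u v
    unfolding qh_length_def using arclength_integral_subpath[OF \<gamma>(1) cont[OF \<gamma>(2)] that] .
  have split: "qh_length \<Omega> \<gamma> = qh_length \<Omega> (subpath 0 a \<gamma>) +
      (qh_length \<Omega> (subpath a b \<gamma>) + qh_length \<Omega> (subpath b 1 \<gamma>))"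
  proof -
    have "(\<lambda>s. ?k (arclength_param \<gamma> s)) integrable_on {0..arclength \<gamma>}"
      by (intro integrable_continuous_real continuous_on_compose_arclength_param \<gamma> cont)
    then have "(\<lambda>s. ?k (arclength_param \<gamma> s)) integrable_on {variation \<gamma> 0 a..variation \<gamma> 0 1}"
      by (rule integrable_on_subinterval) (use variation_in_range[OF \<gamma>(1), of a] ab in \<open>auto simp: arclength_eq\<close>)
    moreover have "variation \<gamma> 0 a \<le> variation \<gamma> 0 b" "variation \<gamma> 0 b \<le> variation \<gamma> 0 1"
      using variation_add[OF \<gamma>(1), of 0 a b] variation_nonneg[OF \<gamma>(1), of a b]
        variation_in_range[OF \<gamma>(1), of b] ab by (auto simp: arclength_eq)
    ultimately have "qh_length \<Omega> (subpath a 1 \<gamma>) = qh_length \<Omega> (subpath a b \<gamma>) + qh_length \<Omega> (subpath b 1 \<gamma>)"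
      using ab by (simp add: I Henstock_Kurzweil_Integration.integral_combine)
    then show ?thesis
      using arclength_integral_split[OF \<gamma>(1) cont[OF \<gamma>(2)], of a] ab by (simp add: qh_length_def)
  qed
  show ?thesis
    unfolding qh_metric_def
  proof (rule cINF_greatest)
    have "subpath a b \<gamma> \<in> rectifiable_paths_between \<Omega> (\<gamma> a) (\<gamma> b)"
      using sub[OF ab] by (simp add: rectifiable_paths_between_def)
    then show "rectifiable_paths_between \<Omega> (\<gamma> a) (\<gamma> b) \<noteq> {}" by blast
    fix h assume "h \<in> rectifiable_paths_between \<Omega> (\<gamma> a) (\<gamma> b)"
    then have h: "rectifiable_path h" "path_image h \<subseteq> \<Omega>" "pathstart h = \<gamma> a" "pathfinish h = \<gamma> b"
      by (auto simp: rectifiable_paths_between_def)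
    let ?g1 = "subpath 0 a \<gamma>" and ?g3 = "subpath b 1 \<gamma>"
    have g1: "rectifiable_path ?g1" "path_image ?g1 \<subseteq> \<Omega>" "pathstart ?g1 = x" "pathfinish ?g1 = \<gamma> a"
      using sub[of 0 a] ab \<gamma>(3) by (simp_all add: pathstart_def[of \<gamma>])
    have g3: "rectifiable_path ?g3" "path_image ?g3 \<subseteq> \<Omega>" "pathstart ?g3 = \<gamma> b" "pathfinish ?g3 = y"
      using sub[of b 1] ab \<gamma>(4) by (simp_all add: pathfinish_def[of \<gamma>])
    let ?h3 = "h +++ ?g3"
    have h3: "rectifiable_path ?h3" "path_image ?h3 \<subseteq> \<Omega>" "pathstart ?h3 = \<gamma> a" "pathfinish ?h3 = y"
      using h g3 by (auto simp: path_image_join intro: rectifiable_path_join)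
    have "?g1 +++ ?h3 \<in> rectifiable_paths_between \<Omega> x y"
      using g1 h3 by (auto simp: rectifiable_paths_between_def path_image_join intro!: rectifiable_path_join)
    from qh_metric_le[OF this] have "qh_metric \<Omega> x y \<le> qh_length \<Omega> (?g1 +++ ?h3)" .
    also have "\<dots> = qh_length \<Omega> ?g1 + qh_length \<Omega> ?h3"
      unfolding qh_length_def using g1 h3 by (intro arclength_integral_join cont) auto
    also have "qh_length \<Omega> ?h3 = qh_length \<Omega> h + qh_length \<Omega> ?g3"
      unfolding qh_length_def using g3 h by (intro arclength_integral_join cont) auto
    finally show "qh_length \<Omega> (subpath a b \<gamma>) \<le> qh_length \<Omega> h"
      using split \<gamma>(5) by simp
  qed
qed

lemma geodesic_integral_le:
  assumes \<Omega>: "open \<Omega>" "frontier \<Omega> \<noteq> {}" and geod: "qh_geodesic \<Omega> x y \<gamma>"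
    and uv: "0 \<le> u" "u \<le> v" "v \<le> arclength \<gamma>"
  shows "integral {u..v} (\<lambda>s. 1 / boundary_dist \<Omega> (arclength_param \<gamma> s)) \<le>
    qh_metric \<Omega> (arclength_param \<gamma> u) (arclength_param \<gamma> v)"
proof -
  have \<gamma>: "rectifiable_path \<gamma>" "path_image \<gamma> \<subseteq> \<Omega>"
    using geod by (auto simp: qh_geodesic_def rectifiable_paths_between_def)
  obtain a where a: "a \<in> {0..1}" "variation \<gamma> 0 a = u"
    by (rule variation_onto[OF \<gamma>(1), of u]) (use uv in auto)
  obtain b where b: "b \<in> {0..1}" "variation \<gamma> 0 b = v"
    by (rule variation_onto[OF \<gamma>(1), of v]) (use uv in auto)
  \<comment> \<open>The chosen parameters may come in the wrong order, but only if
    \<open>u = v\<close>; replacing \<open>b\<close> by \<open>a\<close> then leaves the arclength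
    value unchanged.\<close>
  define b' where "b' = max a b"
  have "variation \<gamma> 0 b' = v"
    using variation_add[OF \<gamma>(1), of 0 b a] variation_nonneg[OF \<gamma>(1), of b a] a b uv
    by (auto simp: b'_def max_def)
  moreover have ab: "0 \<le> a" "a \<le> b'" "b' \<le> 1" using a b by (auto simp: b'_def)
  ultimately have b': "variation \<gamma> 0 b' = v" "b' \<in> {0..1}" by auto
  have "continuous_on (path_image \<gamma>) (\<lambda>z. 1 / boundary_dist \<Omega> z)"
    using continuous_on_inverse_boundary_dist[OF \<Omega>] \<gamma>(2) continuous_on_subset by blast
  from arclength_integral_subpath[OF \<gamma>(1) this ab]
  have "integral {u..v} (\<lambda>s. 1 / boundary_dist \<Omega> (arclength_param \<gamma> s)) = qh_length \<Omega> (subpath a b' \<gamma>)"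
    by (simp add: qh_length_def a b')
  also have "\<dots> \<le> qh_metric \<Omega> (\<gamma> a) (\<gamma> b')"
    by (rule geodesic_subpath_le[OF \<Omega> geod ab])
  finally show ?thesis
    using arclength_param_variation[OF \<gamma>(1) a(1)] arclength_param_variation[OF \<gamma>(1) b'(2)] a b' by simp
qed

text \<open>A ball is connected, so if it met both \<open>\<Omega>\<close> and the complement it
  would contain a frontier point, at distance at most \<open>r\<close> from
  \<open>x\<close>.\<close>

lemma cball_subset_of_boundary_dist:
  fixes x :: "'a::real_normed_vector"
  assumes "x \<in> \<Omega>" "r < boundary_dist \<Omega> x"
  shows "cball x r \<subseteq> \<Omega>"
proof (rule ccontr)
  assume "\<not> cball x r \<subseteq> \<Omega>"
  then obtain z where z: "z \<in> cball x r" "z \<notin> \<Omega>" by blast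
  then have "x \<in> cball x r" using zero_le_dist[of x z] by (simp del: zero_le_dist)
  then have "cball x r \<inter> \<Omega> \<noteq> {}" "cball x r - \<Omega> \<noteq> {}"
    using z assms(1) by blast+
  from connected_Int_frontier[OF convex_connected[OF convex_cball] this]
  obtain w where "w \<in> frontier \<Omega>" "dist x w \<le> r" by auto
  then show False
    using infdist_le[of w "frontier \<Omega>" x] assms by (simp add: boundary_dist_def)
qed

text \<open>The segment from \<open>x\<close> to \<open>y\<close> is a competitor: by the Lipschitz
  property, the boundary distance along it is at least half its value at \<open>x\<close>.\<close>

lemma qh_metric_near:
  fixes x y :: "'a::real_normed_vector"
  assumes \<Omega>: "open \<Omega>" "frontier \<Omega> \<noteq> {}" and x: "x \<in> \<Omega>" and xy: "2 * dist x y \<le> boundary_dist \<Omega> x"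
  shows "qh_metric \<Omega> x y \<le> 2 * dist x y / boundary_dist \<Omega> x"
proof -
  let ?d = "boundary_dist \<Omega> x" and ?g = "linepath x y"
  have d: "0 < ?d" using boundary_dist_pos[OF \<Omega> x] .
  have near: "dist x z \<le> dist x y" if "z \<in> closed_segment x y" for z
    using segment_bound(1)[OF that] by (simp add: dist_norm norm_minus_commute)
  have im: "path_image ?g \<subseteq> \<Omega>"
  proof -
    have "cball x (dist x y) \<subseteq> \<Omega>"
      using d xy zero_le_dist[of x y] by (intro cball_subset_of_boundary_dist[OF x]) linarith
    then show ?thesis using near by auto
  qed
  have ker: "1 / boundary_dist \<Omega> z \<le> 2 / ?d" if "z \<in> path_image ?g" for z
  proof -
    have "?d / 2 \<le> boundary_dist \<Omega> z"
      using boundary_dist_lipschitz[of \<Omega> x z] near[of z] that xy by auto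
    then have "1 / boundary_dist \<Omega> z \<le> 1 / (?d / 2)" using d by (intro frac_le) auto
    then show ?thesis by simp
  qed
  have "qh_metric \<Omega> x y \<le> qh_length \<Omega> ?g"
    using im by (intro qh_metric_le) (auto simp: rectifiable_paths_between_def linepath_rectifiable)
  also have "\<dots> \<le> integral {0..arclength ?g} (\<lambda>s. 2 / ?d)"
    unfolding qh_length_def arclength_integral_def
  proof (rule integral_le)
    show "(\<lambda>s. 1 / boundary_dist \<Omega> (arclength_param ?g s)) integrable_on {0..arclength ?g}"
      using continuous_on_subset[OF continuous_on_inverse_boundary_dist[OF \<Omega>] im]
      by (intro integrable_continuous_real continuous_on_compose_arclength_param linepath_rectifiable)
    show "1 / boundary_dist \<Omega> (arclength_param ?g s) \<le> 2 / ?d" if "s \<in> {0..arclength ?g}" for s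
      by (intro ker arclength_param_in_image linepath_rectifiable that)
  qed (rule integrable_continuous_real, rule continuous_on_const)
  also have "\<dots> = 2 * dist x y / ?d"
    by (simp add: linepath_rectifiable)
  finally show ?thesis .
qed

theorem theorem2p2:
  fixes \<Omega> :: "(real ^ 'n) set"
    and \<delta> c c\<^sub>\<phi> d\<^sub>\<phi> :: real
    and \<phi> :: "real \<Rightarrow> real"
    and x y :: "real ^ 'n"
    and \<gamma> :: "real \<Rightarrow> real ^ 'n"
  assumes domain: "is_domain \<Omega>" "\<Omega> \<noteq> UNIV"
    and "\<delta> > 0" and "c \<ge> 1"
    and phi_incr: "mono_on {0..} \<phi>"
    and phi_nonneg: "\<forall>t\<ge>0. \<phi> t \<ge> 0"
    and bounds: "d\<^sub>\<phi> \<ge> c\<^sub>\<phi>" "c\<^sub>\<phi> \<ge> c" "c \<ge> 2"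
    and phi_c: "\<forall>t\<ge>c\<^sub>\<phi>. 1 + \<phi> t \<le> t / (2 * c)"
    and phi_d: "\<forall>t\<ge>d\<^sub>\<phi>. 1 + \<phi> t \<le> t / (c\<^sub>\<phi> * exp (8 * c\<^sub>\<phi>))"
    and "x \<in> \<Omega>" and "y \<in> \<Omega>"
    and geod: "qh_geodesic \<Omega> x y \<gamma>"
    and i: "\<forall>u\<in>path_image \<gamma>. \<forall>v\<in>path_image \<gamma>. norm (u - v) < \<delta> \<longrightarrow>
        qh_metric \<Omega> u v \<le>
          c * (1 + 1/2 * (\<phi> (norm (u - v) / boundary_dist \<Omega> u)
                        + \<phi> (norm (u - v) / boundary_dist \<Omega> v)))"
    and ii: "norm (x - y) < \<delta> / (10 * c\<^sub>\<phi>)"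
  shows "arclength \<gamma> \<le> (8 * d\<^sub>\<phi>) * norm (x - y) \<and>
    (\<forall>t\<in>{0..1}. min (arclength (subpath 0 t \<gamma>)) (arclength (subpath t 1 \<gamma>))
        \<le> (2 * d\<^sub>\<phi>\<^sup>2) * boundary_dist \<Omega> (\<gamma> t))"
proof -
  define C where "C = c\<^sub>\<phi>"
  define p where "p = arclength_param \<gamma>"
  define f where "f s = boundary_dist \<Omega> (p s)" for s
  define \<Lambda> where "\<Lambda> = arclength \<gamma>"
  define \<rho> where "\<rho> = dist x y"
  have \<gamma>: "rectifiable_path \<gamma>" "path_image \<gamma> \<subseteq> \<Omega>" "pathstart \<gamma> = x" "pathfinish \<gamma> = y"
    using geod by (auto simp: qh_geodesic_def rectifiable_paths_between_def)
  \<comment> \<open>Only the empty set and the whole space have empty frontier, by connectedness of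
    the space.\<close>
  have \<Omega>: "open \<Omega>" "frontier \<Omega> \<noteq> {}"
    using domain by (auto simp: is_domain_def frontier_eq_empty)
  have \<Lambda>0: "0 \<le> \<Lambda>"
    using variation_nonneg[OF \<gamma>(1), of 0 1] by (simp add: \<Lambda>_def arclength_eq)
  have C: "2 \<le> C" using bounds by (simp add: C_def)
  have p_im: "p s \<in> path_image \<gamma>" if "s \<in> {0..\<Lambda>}" for s
    using arclength_param_in_image[OF \<gamma>(1)] that by (simp add: p_def \<Lambda>_def)
  have p_ends: "p 0 = x" "p \<Lambda> = y"
    using arclength_param_ends[OF \<gamma>(1)] \<gamma> by (auto simp: p_def \<Lambda>_def)
  interpret admissible_arc p f \<phi> \<Lambda> \<delta> c C
  proof
    show p_lip: "dist (p u) (p v) \<le> \<bar>u - v\<bar>" if "u \<in> {0..\<Lambda>}" "v \<in> {0..\<Lambda>}" for u v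
      using arclength_param_lipschitz[OF \<gamma>(1)] that by (simp add: p_def \<Lambda>_def)
    show "\<bar>f u - f v\<bar> \<le> \<bar>u - v\<bar>" if "u \<in> {0..\<Lambda>}" "v \<in> {0..\<Lambda>}" for u v
      using p_lip[OF that] boundary_dist_lipschitz[of \<Omega> "p u" "p v"] by (simp add: f_def)
    show "0 < f u" if "u \<in> {0..\<Lambda>}" for u
      using boundary_dist_pos[OF \<Omega>] p_im[OF that] \<gamma>(2) by (auto simp: f_def)
    show "1 + \<phi> t \<le> t / (2 * c)" if "C \<le> t" for t
      using phi_c that by (simp add: C_def)
    fix u v assume uv: "0 \<le> u" "u \<le> v" "v \<le> \<Lambda>" and d: "dist (p u) (p v) < \<delta>"
    have "integral {u..v} (\<lambda>s. 1 / f s) \<le> qh_metric \<Omega> (p u) (p v)"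
      using geodesic_integral_le[OF \<Omega> geod] uv by (simp add: f_def p_def \<Lambda>_def)
    also have "\<dots> \<le> c * (1 + 1/2 * (\<phi> (dist (p u) (p v) / f u) + \<phi> (dist (p u) (p v) / f v)))"
      using i[rule_format, OF p_im p_im, of u v] d uv by (simp add: f_def dist_norm)
    finally show "integral {u..v} (\<lambda>s. 1 / f s) \<le>
        c * (1 + 1/2 * (\<phi> (dist (p u) (p v) / f u) + \<phi> (dist (p u) (p v) / f v)))" .
  qed (use phi_incr bounds in \<open>auto simp: C_def\<close>)
  have dphi: "C * exp (8 * C) \<le> d\<^sub>\<phi>" "2 \<le> d\<^sub>\<phi>"
  proof -
    show "2 \<le> d\<^sub>\<phi>" using bounds by simp
    \<comment> \<open>Evaluate the second growth condition at \<open>t = d\<^sub>\<phi>\<close>,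
      where its left side is at least 1.\<close>
    then have "1 \<le> d\<^sub>\<phi> / (C * exp (8 * C))"
      using phi_d[rule_format, of "d\<^sub>\<phi>"] phi_nonneg[rule_format, of "d\<^sub>\<phi>"] by (simp add: C_def)
    then show "C * exp (8 * C) \<le> d\<^sub>\<phi>" using C by (simp add: field_simps)
  qed
  have \<rho>: "0 \<le> \<rho>" "10 * C * \<rho> < \<delta>"
    using ii C by (auto simp: \<rho>_def C_def dist_norm field_simps)
  define F where "F = exp (8 * C)"
  have EF: "exp (1 + 6 * C) \<le> F" using C by (simp add: F_def)
  have F1: "8 * C \<le> F" "1 \<le> F"
    using exp_ge_add_one_self[of "8 * C"] C unfolding F_def by linarith+
  have "\<Lambda> \<le> 8 * d\<^sub>\<phi> * \<rho> \<and> (\<forall>s\<in>{0..\<Lambda>}. min s (\<Lambda> - s) \<le> 2 * d\<^sub>\<phi>\<^sup>2 * f s)"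
  proof (cases "2 * \<rho> \<le> f 0")
    case True
    have f0: "0 < f 0" using f_pos \<Lambda>0 by simp
    have k: "K 0 \<Lambda> \<le> 2 * \<rho> / f 0"
    proof -
      have "K 0 \<Lambda> \<le> qh_metric \<Omega> x y"
        using geodesic_integral_le[OF \<Omega> geod, of 0 \<Lambda>] \<Lambda>0 p_ends by (simp add: f_def p_def \<Lambda>_def)
      also have "\<dots> \<le> 2 * \<rho> / f 0"
        using qh_metric_near[OF \<Omega> \<open>x \<in> \<Omega>\<close>, of y] True by (simp add: f_def p_ends \<rho>_def)
      finally show ?thesis .
    qed
    define k where "k = 2 * \<rho> / f 0"
    have k01: "0 \<le> k" "k \<le> 1" using True f0 \<rho> by (auto simp: k_def)
    have "f 0 + (\<Lambda> - 0) \<le> f 0 * exp (K 0 \<Lambda>)" using \<Lambda>0 by (intro harnack) auto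
    also have "\<dots> \<le> f 0 * exp k" using k f0 by (simp add: k_def)
    \<comment> \<open>Since \<open>k \<le> 1\<close>, the exponential is at most
      \<open>1 + 2 * k\<close>, which keeps the length bound linear in
      \<open>\<rho>\<close>.\<close>
    also have "\<dots> \<le> f 0 * (1 + k + k\<^sup>2)" using f0 exp_bound[OF k01] by simp
    also have "\<dots> \<le> f 0 * (1 + 2 * k)"
      using f0 k01 by (intro mult_left_mono) (auto simp: power2_eq_square mult_left_le)
    also have "\<dots> = f 0 + 4 * \<rho>" using f0 by (simp add: k_def field_simps)
    finally have L: "\<Lambda> \<le> 4 * \<rho>" by simp
    have "4 * \<rho> \<le> 8 * d\<^sub>\<phi> * \<rho>" using dphi \<rho> by (intro mult_right_mono) auto
    then have 1: "\<Lambda> \<le> 8 * d\<^sub>\<phi> * \<rho>" using L by linarith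
    have 2: "min s (\<Lambda> - s) \<le> 2 * d\<^sub>\<phi>\<^sup>2 * f s" if s: "s \<in> {0..\<Lambda>}" for s
    proof -
      have fs: "0 < f s" using f_pos s by auto
      have "K 0 s \<le> K 0 \<Lambda>" using s by (intro K_mono) auto
      then have Ks: "exp (K 0 s) \<le> 3"
        using k k01 exp_le by (smt (verit) exp_le_cancel_iff k_def)
      have "f 0 \<le> f s * exp (K 0 s)"
        using harnack'[of 0 s] f_lip[of 0 s] s by auto
      also have "\<dots> \<le> f s * 3" using Ks fs by (intro mult_left_mono) auto
      finally have "f 0 \<le> 3 * f s" by simp
      moreover have "2 * min s (\<Lambda> - s) \<le> \<Lambda>" by (auto simp: min_def)
      \<comment> \<open>The chain is \<open>min s (\<Lambda> - s) \<le> \<Lambda> / 2 \<le> 2 *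
        \<rho> \<le> f 0 \<le> 3 * f s\<close>.\<close>
      ultimately have "min s (\<Lambda> - s) \<le> 3 * f s" using L True by linarith
      also have "\<dots> \<le> 2 * d\<^sub>\<phi>\<^sup>2 * f s"
        using fs power_mono[of 2 "d\<^sub>\<phi>" 2] dphi by (intro mult_right_mono) auto
      finally show ?thesis .
    qed
    show ?thesis using 1 2 by blast
  next
    case False
    then have "0 < \<rho>" using f_pos[of 0] \<Lambda>0 by auto
    note arc_bounds = arc_bounds[OF \<Lambda>0 this \<rho>(2)]
    have ab: "\<Lambda> \<le> 6 * C * \<rho> + 2 * \<rho> * exp (1 + 6 * C)"
      "\<And>s. s \<in> {0..\<Lambda>} \<Longrightarrow> min s (\<Lambda> - s) \<le> (6 * C + exp (1 + 6 * C)) * exp (1 + 6 * C) * f s"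
      using arc_bounds False by (auto simp: p_ends \<rho>_def)
    have CF: "2 * F \<le> C * F" using C F1 by simp
    \<comment> \<open>The left side is at most \<open>F + 2 * F\<close>, and \<open>C * F\<close> is
      at most \<open>d\<^sub>\<phi>\<close>.\<close>
    have "6 * C + 2 * exp (1 + 6 * C) \<le> 8 * (C * F)" using EF F1 CF by linarith
    also have "\<dots> \<le> 8 * d\<^sub>\<phi>" using dphi by (simp add: F_def)
    finally have "(6 * C + 2 * exp (1 + 6 * C)) * \<rho> \<le> 8 * d\<^sub>\<phi> * \<rho>" using \<rho> by (intro mult_right_mono)
    then have 1: "\<Lambda> \<le> 8 * d\<^sub>\<phi> * \<rho>" using ab(1) by (simp add: algebra_simps)
    \<comment> \<open>Each factor of the cigar constant is at most
      \<open>2 * F \<le> C * F \<le> d\<^sub>\<phi>\<close>; the product of the two accounts for the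
      square of \<open>d\<^sub>\<phi>\<close> in the conclusion.\<close>
    have "6 * C + exp (1 + 6 * C) \<le> C * F" "exp (1 + 6 * C) \<le> C * F"
      using EF F1 CF C by linarith+
    then have "(6 * C + exp (1 + 6 * C)) * exp (1 + 6 * C) \<le> (C * F) * (C * F)"
      using C F1 by (intro mult_mono) auto
    also have "\<dots> \<le> d\<^sub>\<phi> * d\<^sub>\<phi>" using dphi C F1 by (intro mult_mono) (auto simp: F_def)
    finally have B: "(6 * C + exp (1 + 6 * C)) * exp (1 + 6 * C) \<le> 2 * d\<^sub>\<phi>\<^sup>2"
      using zero_le_square[of "d\<^sub>\<phi>"] unfolding power2_eq_square by linarith
    have 2: "min s (\<Lambda> - s) \<le> 2 * d\<^sub>\<phi>\<^sup>2 * f s" if s: "s \<in> {0..\<Lambda>}" for s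
      using ab(2)[OF s] mult_right_mono[OF B, of "f s"] f_pos[OF s] by linarith
    show ?thesis using 1 2 by blast
  qed
  moreover have "min (arclength (subpath 0 t \<gamma>)) (arclength (subpath t 1 \<gamma>)) \<le> 2 * d\<^sub>\<phi>\<^sup>2 * boundary_dist \<Omega> (\<gamma> t)"
    if t: "t \<in> {0..1}" and cigar: "\<forall>s\<in>{0..\<Lambda>}. min s (\<Lambda> - s) \<le> 2 * d\<^sub>\<phi>\<^sup>2 * f s" for t
  proof -
    \<comment> \<open>Apply the bound at the arclength parameter of \<open>\<gamma> t\<close>; by
      additivity, the complementary length is \<open>variation \<gamma> t 1\<close>.\<close>
    have "variation \<gamma> 0 t \<in> {0..\<Lambda>}" using variation_in_range[OF \<gamma>(1) t] by (simp add: \<Lambda>_def)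
    from cigar[rule_format, OF this] show ?thesis
      using variation_add[OF \<gamma>(1), of 0 t 1] t arclength_param_variation[OF \<gamma>(1) t]
      by (simp add: arclength_subpath f_def p_def \<Lambda>_def arclength_eq[of \<gamma>])
  qed
  ultimately show ?thesis by (simp add: \<Lambda>_def \<rho>_def dist_norm)
qed

end
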